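(* Let $k\geq 5$, $r\ge1$, $s_1\geq\cdots\geq s_r\geq 1$ and $\beta\ge0$ be fixed integers with $\gamma=1+\beta\leq k-2$, and let $n$ be sufficiently large (depending on $s_1,\ldots,s_r,k,\gamma$). Let $\mathcal{F}\subseteq\binom{[n]}{k}$ be such that $KG_{n,k}[\mathcal{F}]$ contains no subgraph isomorphic to $K_{s_1,\ldots,s_r,1}$ and $\ell_{r+1}(\mathcal{F})\geq\gamma$. Then $$|\mathcal{F}|\leq\binom{n}{k}-\binom{n-r}{k}-\binom{n-k-r+1}{k-1}+\binom{n-k-r-\gamma+1}{k-\gamma-1}+\gamma s_r.$$ Equality holds if and only if $\mathcal{F}$ is isomorphic to a family $\mathcal{J}^{1,s_r}_{\gamma,r}$ (as defined in the context).
   Context: $KG_{n,k}$ is the Kneser graph on $\binom{[n]}{k}$ (adjacent iff disjoint); $KG_{n,k}[\mathcal{F}]$ is the induced subgraph. $\ell_{r+1}(\mathcal{F})$ is the minimum number of members of $\mathcal{F}$ whose removal leaves a family with no $r+1$ pairwise disjoint members. $\mathcal{S}_i=\{A\in\binom{[n]}{k}:i\in A\}$. Construction $\mathcal{J}^{1,t}_{\gamma,r}$: take $J=\{1,\ldots,r,x_1,\ldots,x_\gamma\}$ (an $(r+\gamma)$-set), a $(k-1)$-set $E\subseteq[n]\setminus J$, and $A_j=E\cup\{x_j\}$ for $j\le\gamma$. Let $\mathcal{S}_r^{[r-1]}(A_1,\ldots,A_\gamma:1)$ be the family of $k$-sets $A$ with $r\in A$, $A\cap[r-1]=\varnothing$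 and $A\cap A_j\neq\varnothing$ for all $j$. For each $j\le\gamma$, let $\mathcal{B}_j$ be a family of $t-1$ distinct $k$-sets $B$ with $B\cap E=\varnothing$ and $J\setminus B=\{1,\ldots,r-1,x_j\}$. Then $\mathcal{J}^{1,t}_{\gamma,r}=\bigcup_{l=1}^{r-1}\mathcal{S}_l\cup\mathcal{S}_r^{[r-1]}(A_1,\ldots,A_\gamma:1)\cup\{A_1,\ldots,A_\gamma\}\cup\mathcal{B}_1\cup\cdots\cup\mathcal{B}_\gamma$. Two families are isomorphic if some permutation of $[n]$ maps one onto the other. *)

theory Defs
  imports
    "Graph_Theory.Graph_Theory"
    "HOL-Library.Ramsey"
    "HOL-Library.Disjoint_Sets"
    "HOL-Combinatorics.Permutations"
begin

text \<open>
  The ground set is \<open>{1..n}\<close>, and \<open>[{1..n}]\<^bsup>k\<^esup>\<close> (the library's \<open>nsets\<close>) is the set of its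
  \<open>k\<close>-subsets. A simple graph is represented by the digraph that has both arcs \<open>(u, v)\<close> and
  \<open>(v, u)\<close> for every edge \<open>uv\<close>.
\<close>

definition kneser_graph :: "nat \<Rightarrow> nat \<Rightarrow> nat set pair_pre_digraph" where
  "kneser_graph n k =
     \<lparr> pverts = [{1..n}]\<^bsup>k\<^esup>,
       parcs = {(A, B). A \<in> [{1..n}]\<^bsup>k\<^esup> \<and> B \<in> [{1..n}]\<^bsup>k\<^esup> \<and> A \<inter> B = {}} \<rparr>"

text \<open>
  In \<open>complete_multipartite ss\<close>, the vertex \<open>(i, a)\<close> is the \<open>a\<close>-th vertex of the \<open>i\<close>-th part
  (both counted from 0), whose size is \<open>ss ! i\<close>.
\<close>

definition complete_multipartite :: "nat list \<Rightarrow> (nat \<times> nat) pair_pre_digraph" where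
  "complete_multipartite ss =
     (let V = (SIGMA i:{..<length ss}. {..<ss ! i})
      in \<lparr> pverts = V, parcs = {(u, v). u \<in> V \<and> v \<in> V \<and> fst u \<noteq> fst v} \<rparr>)"

text \<open>
  A subgraph isomorphic to \<open>H\<close> need not be induced. If \<open>H\<close> is symmetric, then so is every digraph
  isomorphic to it, so for such \<open>H\<close> the digraph notion agrees with the undirected one.
\<close>

definition contains_subgraph :: "('a, 'b) pre_digraph \<Rightarrow> ('c, 'd) pre_digraph \<Rightarrow> bool" where
  "contains_subgraph G H \<longleftrightarrow> (\<exists>H'. subgraph H' G \<and> digraph_iso H H')"

text \<open>
  This is \<open>\<ell>\<^sub>q(\<F>)\<close>. For \<open>q \<ge> 1\<close> and finite \<open>\<F>\<close> the minimum
  ranges over a nonempty set, because all of \<open>\<F>\<close> may be removed.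
\<close>

definition ell :: "nat \<Rightarrow> 'a set set \<Rightarrow> nat" where
  "ell q \<F> = (LEAST m. \<exists>D\<subseteq>\<F>. finite D \<and> card D = m \<and>
                 \<not> (\<exists>P\<subseteq>\<F> - D. finite P \<and> card P = q \<and> disjoint P))"

definition star :: "nat \<Rightarrow> nat \<Rightarrow> nat \<Rightarrow> nat set set" where
  "star n k i = {A \<in> [{1..n}]\<^bsup>k\<^esup>. i \<in> A}"

text \<open>
  This is \<open>\<S>\<^sub>r\<^bsup>[r-1]\<^esup>(A\<^sub>1, \<dots>, A\<^sub>\<gamma> : 1)\<close>; the final 1 says that members meet each \<open>A\<^sub>j\<close> in at
  least one element.
\<close>

definition restricted_star ::
  "nat \<Rightarrow> nat \<Rightarrow> nat \<Rightarrow> nat \<Rightarrow> (nat \<Rightarrow> nat set) \<Rightarrow> nat set set" where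
  "restricted_star n k r \<gamma> A =
     {S \<in> [{1..n}]\<^bsup>k\<^esup>. r \<in> S \<and> S \<inter> {1..r - 1} = {} \<and> (\<forall>j\<in>{1..\<gamma>}. S \<inter> A j \<noteq> {})}"

text \<open>
  \<open>is_J_family n k r \<gamma> t \<G>\<close> says that \<open>\<G>\<close> is one of the families \<open>\<J>\<^bsup>1,t\<^esup>\<^bsub>\<gamma>,r\<^esub>\<close>;
  these are not unique, as they depend on the choice of \<open>x\<close>, \<open>E\<close> and \<open>B\<close>.
  Meant for \<open>r, k, t \<ge> 1\<close>.
\<close>

definition is_J_family :: "nat \<Rightarrow> nat \<Rightarrow> nat \<Rightarrow> nat \<Rightarrow> nat \<Rightarrow> nat set set \<Rightarrow> bool" where
  "is_J_family n k r \<gamma> t \<G> \<longleftrightarrow>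
     (\<exists>(x :: nat \<Rightarrow> nat) (E :: nat set) (B :: nat \<Rightarrow> nat set set).
        let J = {1..r} \<union> x ` {1..\<gamma>};
            A = (\<lambda>j. insert (x j) E)
        in J \<in> nsets {1..n} (r + \<gamma>) \<and>
           E \<in> nsets ({1..n} - J) (k - 1) \<and>
           (\<forall>j\<in>{1..\<gamma>}.
              B j \<subseteq> {S \<in> [{1..n}]\<^bsup>k\<^esup>. S \<inter> E = {} \<and> J - S = insert (x j) {1..r - 1}} \<and>
              card (B j) = t - 1) \<and>
           \<G> = (\<Union>l\<in>{1..r - 1}. star n k l) \<union> restricted_star n k r \<gamma> A
                \<union> A ` {1..\<gamma>} \<union> (\<Union>j\<in>{1..\<gamma>}. B j))"

definition isomorphic_families :: "nat \<Rightarrow> nat set set \<Rightarrow> nat set set \<Rightarrow> bool" where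
  "isomorphic_families n \<F> \<G> \<longleftrightarrow> (\<exists>\<pi>. \<pi> permutes {1..n} \<and> \<G> = (`) \<pi> ` \<F>)"

end

theory Submission
  imports Defs
begin

text \<open>
  Call an element popular if it lies in at least \<open>C n\<^sup>k\<^sup>-\<^sup>2\<close> members. A complete multipartite
  configuration extends greedily through popular elements, and a family without popular elements that
  is larger than a constant times \<open>n\<^sup>k\<^sup>-\<^sup>2\<close> has a large matching, hence the forbidden subgraph.
  So a family of at least the extremal size has \<open>r - 1\<close> popular elements, and the members avoiding
  them form a family of Kneser degree less than \<open>t = s\<^sub>r\<close> that is \<open>\<gamma>\<close>-robustly
  non-intersecting. In such a family every pair that lies in many members meets every member. Counting
  shows that there are at least \<open>k - 1 \<ge> 4\<close> such pairs. They pairwise meet, so they share a centre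
  \<open>c\<close>; the members avoiding \<open>c\<close> are then of the form \<open>E \<union> {x}\<close> for a fixed \<open>(k - 1)\<close>-set
  \<open>E\<close>, and counting the remaining members according to how they meet these sets gives the bound
  and its equality case.
\<close>

section \<open>Counting\<close>

text \<open>The hypothesis \<open>k \<ge> 5\<close> enters through the pairs: pairwise meeting pairs
  form a star or lie in a triangle, and a triangle has only three, so four pairs rule it out. The
  number \<open>k - 1\<close> is a leading coefficient: with one centre on \<open>m\<close> points
  the extremal size is at least \<open>k - 1\<close> times \<open>(m - k) choose (k - 2)\<close>,
  one pair lies in at most \<open>(m - 2) choose (k - 2)\<close> members, and these two binomials
  differ only in lower order. Once the centre is known, the obstacle is that nothing bounds in
  advance the number \<open>q\<close> of members avoiding it. Robustness gives
  \<open>q \<ge> \<gamma>\<close>. One such member \<open>insert x E\<close> beyond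
  \<open>\<gamma>\<close> brings in at most \<open>t\<close> sets, itself and its neighbours, but
  forbids nearly all sets that avoid \<open>E\<close>, contain the old exceptional points and miss
  \<open>x\<close>. The condition \<open>\<gamma> \<le> k - 2\<close> makes this loss grow with
  \<open>m\<close>.\<close>

lemma card_nsets_contain_avoid:
  assumes "finite V" "Y \<subseteq> V" "Z \<subseteq> V" "Y \<inter> Z = {}" "card Y \<le> k"
  shows "card {S \<in> [V]\<^bsup>k\<^esup>. Y \<subseteq> S \<and> S \<inter> Z = {}} = (card V - card Y - card Z) choose (k - card Y)"
proof -
  have fY: "finite Y" and fZ: "finite Z" by (meson assms finite_subset)+
  have "bij_betw (\<lambda>S. S - Y) {S \<in> [V]\<^bsup>k\<^esup>. Y \<subseteq> S \<and> S \<inter> Z = {}} {T. T \<subseteq> V - Y - Z \<and> card T = k - card Y}"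
  proof (rule bij_betwI[where g = "\<lambda>T. T \<union> Y"])
    show "(\<lambda>S. S - Y) \<in> {S \<in> [V]\<^bsup>k\<^esup>. Y \<subseteq> S \<and> S \<inter> Z = {}} \<rightarrow> {T. T \<subseteq> V - Y - Z \<and> card T = k - card Y}"
      using fY by (auto simp: nsets_def card_Diff_subset)
    show "(\<lambda>T. T \<union> Y) \<in> {T. T \<subseteq> V - Y - Z \<and> card T = k - card Y} \<rightarrow> {S \<in> [V]\<^bsup>k\<^esup>. Y \<subseteq> S \<and> S \<inter> Z = {}}"
    proof
      fix T assume T: "T \<in> {T. T \<subseteq> V - Y - Z \<and> card T = k - card Y}"
      then have "finite T" using assms(1) finite_subset by blast
      moreover have "card (T \<union> Y) = card T + card Y"
        using T fY \<open>finite T\<close> by (intro card_Un_disjoint) auto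
      ultimately show "T \<union> Y \<in> {S \<in> [V]\<^bsup>k\<^esup>. Y \<subseteq> S \<and> S \<inter> Z = {}}"
        using T fY assms by (auto simp: nsets_def)
    qed
  qed auto
  then have "card {S \<in> [V]\<^bsup>k\<^esup>. Y \<subseteq> S \<and> S \<inter> Z = {}} = card {T. T \<subseteq> V - Y - Z \<and> card T = k - card Y}"
    by (rule bij_betw_same_card)
  also have "\<dots> = card (V - Y - Z) choose (k - card Y)"
    using assms(1) by (simp add: n_subsets)
  also have "card (V - Y - Z) = card V - card Y - card Z"
    using assms fY fZ by (subst card_Diff_subset; (subst card_Diff_subset)?) auto
  finally show ?thesis .
qed

lemma card_nsets_contain_avoid_le:
  assumes "finite V" "Y \<subseteq> V" "Z \<subseteq> V" "Y \<inter> Z = {}"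
  shows "card {S \<in> [V]\<^bsup>k\<^esup>. Y \<subseteq> S \<and> S \<inter> Z = {}} \<le> (card V - card Y - card Z) choose (k - card Y)"
proof (cases "card Y \<le> k")
  case False
  have "{S \<in> [V]\<^bsup>k\<^esup>. Y \<subseteq> S \<and> S \<inter> Z = {}} = {}"
    using False card_mono by (fastforce simp: nsets_def)
  then show ?thesis by (metis card.empty zero_le)
qed (use assms card_nsets_contain_avoid in \<open>simp add: card_nsets_contain_avoid\<close>)

lemma binomial_le_pow': "n choose k \<le> n ^ k"
  by (cases "k \<le> n") (auto simp: binomial_le_pow binomial_eq_0)

lemma card_nsets_contain_le:
  assumes "finite V" "Y \<subseteq> V"
  shows "card {S \<in> [V]\<^bsup>k\<^esup>. Y \<subseteq> S} \<le> card V ^ (k - card Y)"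
proof -
  have "card {S \<in> [V]\<^bsup>k\<^esup>. Y \<subseteq> S} \<le> (card V - card Y) choose (k - card Y)"
    using card_nsets_contain_avoid_le[OF assms, of "{}" k] by simp
  also have "\<dots> \<le> (card V - card Y) ^ (k - card Y)" by (rule binomial_le_pow')
  also have "\<dots> \<le> card V ^ (k - card Y)" by (simp add: power_mono)
  finally show ?thesis .
qed

text \<open>Meeting \<open>W\<close> fixes one further element, so a \<open>W\<close> of bounded
  size can spoil only a lower-order number of sets through \<open>Y\<close>. Heavy pairs and popular
  elements are both exploited through this estimate.\<close>

lemma card_nsets_contain_hit_le:
  assumes "finite V" "Y \<subseteq> V" "W \<inter> Y = {}" "finite W"
  shows "card {S \<in> [V]\<^bsup>k\<^esup>. Y \<subseteq> S \<and> S \<inter> W \<noteq> {}} \<le> card W * card V ^ (k - card Y - 1)"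
proof -
  have fY: "finite Y" using assms finite_subset by auto
  have "{S \<in> [V]\<^bsup>k\<^esup>. Y \<subseteq> S \<and> S \<inter> W \<noteq> {}} \<subseteq> (\<Union>w\<in>W \<inter> V. {S \<in> [V]\<^bsup>k\<^esup>. insert w Y \<subseteq> S})"
    by (auto simp: nsets_def)
  then have "card {S \<in> [V]\<^bsup>k\<^esup>. Y \<subseteq> S \<and> S \<inter> W \<noteq> {}} \<le> card (\<Union>w\<in>W \<inter> V. {S \<in> [V]\<^bsup>k\<^esup>. insert w Y \<subseteq> S})"
    using assms by (intro card_mono) (auto simp: finite_imp_finite_nsets)
  also have "\<dots> \<le> (\<Sum>w\<in>W \<inter> V. card {S \<in> [V]\<^bsup>k\<^esup>. insert w Y \<subseteq> S})"
    using assms by (intro card_UN_le) auto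
  also have "\<dots> \<le> (\<Sum>w\<in>W \<inter> V. card V ^ (k - card Y - 1))"
  proof (rule sum_mono)
    fix w assume w: "w \<in> W \<inter> V"
    have "card (insert w Y) = card Y + 1" using w assms fY by (subst card_insert_disjoint) auto
    then show "card {S \<in> [V]\<^bsup>k\<^esup>. insert w Y \<subseteq> S} \<le> card V ^ (k - card Y - 1)"
      using card_nsets_contain_le[of V "insert w Y" k] w assms by auto
  qed
  also have "\<dots> \<le> card W * card V ^ (k - card Y - 1)"
    using assms by (simp add: card_mono)
  finally show ?thesis .
qed

text \<open>A polynomial of degree \<open>j\<close> outgrows every constant multiple of degree
  \<open>j - 1\<close>, also after a shift by \<open>a\<close>. Every asymptotic inequality required
  of \<open>n\<close> is an instance.\<close>

lemma binomial_eventually_gt: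
  assumes "j \<ge> 1"
  shows "\<exists>m0. \<forall>m\<ge>m0. C * m ^ (j - 1) < (m - a) choose j"
proof (intro exI allI impI)
  \<comment> \<open>The summand \<open>C * (2 * j) ^ j\<close> gives
    \<open>C < m / (2 * j) ^ j\<close>; the remaining ones give \<open>m \<le> 2 * (m - a)\<close>
    and \<open>j \<le> m - a\<close>, so that \<open>((m - a) / j) ^ j\<close> is at least
    \<open>(m / (2 * j)) ^ j\<close>.\<close>
  fix m assume m: "m \<ge> C * (2 * j) ^ j + 2 * a + 2 * j + 1"
  have le: "m div 2 \<ge> j" "m \<le> 2 * (m - a)" "m - a \<ge> j" using m by auto
  have "C * (2 * j) ^ j < m" using m by linarith
  then have "real C * (2 * j) ^ j < m" by (metis of_nat_less_iff of_nat_mult)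
  then have "real C < m / (2 * j) ^ j" using assms by (simp add: field_simps)
  then have "C * real m ^ (j - 1) < m / (2 * j) ^ j * real m ^ (j - 1)"
    using m by (intro mult_strict_right_mono) auto
  also have "\<dots> = (real m / (2 * j)) ^ j"
    using power_minus_mult[of j "real m"] assms by (simp add: power_divide mult.commute)
  also have "\<dots> \<le> (real (m - a) / j) ^ j"
  proof (rule power_mono)
    have "real m \<le> 2 * real (m - a)" using le(2) by (metis of_nat_le_iff of_nat_mult of_nat_numeral)
    then show "real m / real (2 * j) \<le> real (m - a) / real j" using assms by (simp add: field_simps)
  qed auto
  also have "\<dots> \<le> real ((m - a) choose j)"
    using binomial_ge_n_over_k_pow_k[OF le(3), where 'a = real] by simp
  finally show "C * m ^ (j - 1) < (m - a) choose j"
    by (metis of_nat_less_iff of_nat_mult of_nat_power)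
qed

lemma card_nsets_hit:
  assumes "finite V" "P \<subseteq> V"
  shows "card {S \<in> [V]\<^bsup>k\<^esup>. S \<inter> P \<noteq> {}} = (card V choose k) - ((card V - card P) choose k)"
proof -
  let ?all = "{S \<in> [V]\<^bsup>k\<^esup>. {} \<subseteq> S \<and> S \<inter> {} = {}}"
  let ?miss = "{S \<in> [V]\<^bsup>k\<^esup>. {} \<subseteq> S \<and> S \<inter> P = {}}"
  have fin: "finite ?miss" using finite_imp_finite_nsets[OF assms(1), of k] by simp
  have "{S \<in> [V]\<^bsup>k\<^esup>. S \<inter> P \<noteq> {}} = ?all - ?miss" by auto
  then have "card {S \<in> [V]\<^bsup>k\<^esup>. S \<inter> P \<noteq> {}} = card ?all - card ?miss"
    using fin by (simp only:) (rule card_Diff_subset, auto)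
  also have "card ?all = card V choose k"
    using card_nsets_contain_avoid[of V "{}" "{}" k] assms by simp
  also have "card ?miss = (card V - card P) choose k"
    using card_nsets_contain_avoid[of V "{}" P k] assms by simp
  finally show ?thesis .
qed

lemma card_nsets_hit_le:
  assumes "finite V" "P \<subseteq> V"
  shows "card {S \<in> [V]\<^bsup>k\<^esup>. S \<inter> P \<noteq> {}} \<le> card P * ((card V - 1) choose (k - 1))"
proof -
  have fP: "finite P" using assms finite_subset by blast
  have "{S \<in> [V]\<^bsup>k\<^esup>. S \<inter> P \<noteq> {}} \<subseteq> (\<Union>p\<in>P. {S \<in> [V]\<^bsup>k\<^esup>. {p} \<subseteq> S \<and> S \<inter> {} = {}})" by auto
  then have "card {S \<in> [V]\<^bsup>k\<^esup>. S \<inter> P \<noteq> {}} \<le> card (\<Union>p\<in>P. {S \<in> [V]\<^bsup>k\<^esup>. {p} \<subseteq> S \<and> S \<inter> {} = {}})"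
    using fP finite_imp_finite_nsets[OF assms(1), of k] by (intro card_mono) simp_all
  also have "\<dots> \<le> (\<Sum>p\<in>P. card {S \<in> [V]\<^bsup>k\<^esup>. {p} \<subseteq> S \<and> S \<inter> {} = {}})" using fP by (rule card_UN_le)
  also have "\<dots> \<le> (\<Sum>p\<in>P. (card V - 1) choose (k - 1))"
  proof (rule sum_mono)
    fix p assume "p \<in> P"
    then show "card {S \<in> [V]\<^bsup>k\<^esup>. {p} \<subseteq> S \<and> S \<inter> {} = {}} \<le> (card V - 1) choose (k - 1)"
      using card_nsets_contain_avoid_le[of V "{p}" "{}" k] assms by auto
  qed
  finally show ?thesis by simp
qed

text \<open>By Pascal's rule the difference is a sum of \<open>d\<close> terms
  \<open>(b + i) choose j\<close> with \<open>i < d\<close>. Bounding them from below extracts a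
  leading coefficient; the companion bound from above shows that a shift by \<open>d\<close> changes
  a binomial only in lower order.\<close>

lemma binomial_diff_lower: "(b choose Suc j) + d * (b choose j) \<le> (b + d) choose Suc j"
proof (induction d)
  case (Suc d)
  have "b choose j \<le> (b + d) choose j" by (rule binomial_right_mono) simp
  then show ?case using Suc by simp
qed simp

lemma binomial_diff_upper: "(b + d) choose Suc j \<le> (b choose Suc j) + d * (b + d) ^ j"
proof (induction d)
  case (Suc d)
  have "(b + d) choose j \<le> (b + d) ^ j" by (rule binomial_le_pow')
  also have "\<dots> \<le> (b + Suc d) ^ j" by (rule power_mono) auto
  finally have "(b + d) choose j \<le> (b + Suc d) ^ j" .
  moreover have "d * (b + d) ^ j \<le> d * (b + Suc d) ^ j" by (intro mult_left_mono power_mono) auto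
  moreover have "(b + Suc d) choose Suc j = ((b + d) choose j) + ((b + d) choose Suc j)" by simp
  ultimately show ?case using Suc by (simp only: mult_Suc)
qed simp

section \<open>The extremal families for one centre\<close>

text \<open>
  \<open>perturbed_HM\<close> is the part of \<open>\<J>\<^bsup>1,t\<^esup>\<^bsub>\<gamma>,r\<^esub>\<close> that avoids the centres
  \<open>1, \<dots>, r - 1\<close>, with centre \<open>c\<close> in the role of \<open>r\<close>; \<open>hm_bound\<close> is its size on \<open>m\<close> points.
\<close>

definition hm_bound :: "nat \<Rightarrow> nat \<Rightarrow> nat \<Rightarrow> nat \<Rightarrow> nat" where
  "hm_bound m k \<gamma> t = ((m - 1) choose (k - 1)) - ((m - k) choose (k - 1))
     + ((m - k - \<gamma>) choose (k - 1 - \<gamma>)) + \<gamma> * t"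

definition perturbed_HM :: "'a set \<Rightarrow> nat \<Rightarrow> 'a \<Rightarrow> nat \<Rightarrow> nat \<Rightarrow> 'a set set \<Rightarrow> bool" where
  "perturbed_HM V k c \<gamma> t G \<longleftrightarrow> (\<exists>x E B. c \<in> V \<and> inj_on x {1..\<gamma>} \<and> x ` {1..\<gamma>} \<subseteq> V - {c} \<and>
     E \<in> [V - insert c (x ` {1..\<gamma>})]\<^bsup>(k - 1)\<^esup> \<and>
     (\<forall>j\<in>{1..\<gamma>}. B j \<subseteq> {S \<in> [V]\<^bsup>k\<^esup>. S \<inter> E = {} \<and> insert c (x ` {1..\<gamma>}) - S = {x j}} \<and> card (B j) = t - 1) \<and>
     G = {S \<in> [V]\<^bsup>k\<^esup>. c \<in> S \<and> (\<forall>j\<in>{1..\<gamma>}. S \<inter> insert (x j) E \<noteq> {})}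
       \<union> (\<lambda>j. insert (x j) E) ` {1..\<gamma>} \<union> (\<Union>j\<in>{1..\<gamma>}. B j))"

lemma card_nsets_point_hit:
  assumes "finite V" "c \<in> V" "E \<in> [V - {c}]\<^bsup>(k - 1)\<^esup>" "k \<ge> 1"
  shows "card {S \<in> [V]\<^bsup>k\<^esup>. c \<in> S \<and> S \<inter> E \<noteq> {}} =
    ((card V - 1) choose (k - 1)) - ((card V - k) choose (k - 1))"
proof -
  let ?all = "{S \<in> [V]\<^bsup>k\<^esup>. {c} \<subseteq> S \<and> S \<inter> {} = {}}"
  let ?miss = "{S \<in> [V]\<^bsup>k\<^esup>. {c} \<subseteq> S \<and> S \<inter> E = {}}"
  have E: "E \<subseteq> V" "c \<notin> E" "card E = k - 1" using assms by (auto simp: nsets_def)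
  have fin: "finite ?miss" using assms finite_imp_finite_nsets[OF assms(1), of k] by auto
  have "{S \<in> [V]\<^bsup>k\<^esup>. c \<in> S \<and> S \<inter> E \<noteq> {}} = ?all - ?miss" by auto
  then have "card {S \<in> [V]\<^bsup>k\<^esup>. c \<in> S \<and> S \<inter> E \<noteq> {}} = card ?all - card ?miss"
    using fin by (simp only:) (rule card_Diff_subset, auto)
  also have "card ?all = (card V - 1) choose (k - 1)"
    using card_nsets_contain_avoid[of V "{c}" "{}" k] assms by simp
  also have "card ?miss = (card V - k) choose (k - 1)"
    using card_nsets_contain_avoid[of V "{c}" E k] assms E by simp
  finally show ?thesis .
qed

text \<open>A set meets every \<open>insert x E\<close> if and only if it meets \<open>E\<close>, or
  avoids \<open>E\<close> and contains all of \<open>X\<close>. These two disjoint cases give the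
  two parts of the formula.\<close>

lemma card_nsets_point_hit_all:
  assumes "finite V" "c \<in> V" "X \<subseteq> V - {c}" "E \<in> [V - insert c X]\<^bsup>(k - 1)\<^esup>" "card X < k"
  shows "card {S \<in> [V]\<^bsup>k\<^esup>. c \<in> S \<and> (\<forall>x\<in>X. S \<inter> insert x E \<noteq> {})} =
    ((card V - 1) choose (k - 1)) - ((card V - k) choose (k - 1))
      + ((card V - k - card X) choose (k - 1 - card X))"
proof -
  let ?hit = "{S \<in> [V]\<^bsup>k\<^esup>. c \<in> S \<and> S \<inter> E \<noteq> {}}"
  let ?full = "{S \<in> [V]\<^bsup>k\<^esup>. insert c X \<subseteq> S \<and> S \<inter> E = {}}"
  have E: "E \<subseteq> V" "c \<notin> E" "card E = k - 1" "E \<inter> X = {}" "E \<in> [V - {c}]\<^bsup>(k - 1)\<^esup>"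
    using assms by (auto simp: nsets_def)
  have fX: "finite X" by (meson assms(1,3) finite_Diff finite_subset)
  have cX: "card (insert c X) = card X + 1" using assms(3) fX by (subst card_insert_disjoint) auto
  have "{S \<in> [V]\<^bsup>k\<^esup>. c \<in> S \<and> (\<forall>x\<in>X. S \<inter> insert x E \<noteq> {})} = ?hit \<union> ?full" by auto
  then have split: "card {S \<in> [V]\<^bsup>k\<^esup>. c \<in> S \<and> (\<forall>x\<in>X. S \<inter> insert x E \<noteq> {})} = card ?hit + card ?full"
    using finite_imp_finite_nsets[OF assms(1), of k] by (simp only:) (rule card_Un_disjoint, auto)
  have "card ?full = (card V - card (insert c X) - card E) choose (k - card (insert c X))"
    using assms E cX by (intro card_nsets_contain_avoid) auto
  also have "card V - card (insert c X) - card E = card V - k - card X"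
    unfolding cX E(3) using assms(5) by linarith
  also have "k - card (insert c X) = k - 1 - card X" unfolding cX by linarith
  finally have full: "card ?full = (card V - k - card X) choose (k - 1 - card X)" .
  have "k \<ge> 1" using assms(5) by linarith
  then show ?thesis
    by (simp only: split full card_nsets_point_hit[OF assms(1,2) E(5)])
qed

text \<open>Without a common point, a pair missing \<open>a\<close> and a pair missing
  \<open>b\<close> complete \<open>{a, b}\<close> to a triangle, and a pair that meets all three
  sides is itself a side. So there would be at most three pairs.\<close>

lemma pairwise_meeting_pairs_star:
  assumes "finite Q" "4 \<le> card Q" "\<And>Y. Y \<in> Q \<Longrightarrow> card Y = 2"
    and meet: "\<And>Y Z. Y \<in> Q \<Longrightarrow> Z \<in> Q \<Longrightarrow> Y \<inter> Z \<noteq> {}"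
  shows "\<exists>c. \<forall>Y\<in>Q. c \<in> Y"
proof (rule ccontr)
  assume no: "\<nexists>c. \<forall>Y\<in>Q. c \<in> Y"
  have "Q \<noteq> {}" using assms(2) by auto
  then obtain a b where ab: "{a, b} \<in> Q" "a \<noteq> b" using assms(3) by (metis card_2_iff ex_in_conv)
  obtain Y where Y: "Y \<in> Q" "a \<notin> Y" using no by blast
  obtain c where c: "Y = {b, c}" "b \<noteq> c"
  proof -
    have "b \<in> Y" using meet[OF ab(1) Y(1)] Y(2) by auto
    then obtain c where "Y = {b, c}" "b \<noteq> c" using assms(3)[OF Y(1)] by (auto simp: card_2_iff)
    then show thesis using that by blast
  qed
  have ac: "a \<noteq> c" using Y c by auto
  obtain Z where Z: "Z \<in> Q" "b \<notin> Z" using no by blast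
  have "Q \<subseteq> {{a, b}, {b, c}, {a, c}}"
  proof
    have Zac: "Z = {a, c}"
    proof -
      have "a \<in> Z" "c \<in> Z" using meet[OF ab(1) Z(1)] meet[OF Y(1) Z(1)] c Z(2) by auto
      then show ?thesis using assms(3)[OF Z(1)] ac by (auto simp: card_2_iff)
    qed
    fix W assume W: "W \<in> Q"
    then obtain u v where uv: "W = {u, v}" "u \<noteq> v" using assms(3) by (metis card_2_iff)
    then show "W \<in> {{a, b}, {b, c}, {a, c}}"
      using meet[OF ab(1) W] meet[OF Y(1) W] meet[OF Z(1) W] unfolding c(1) Zac uv(1)
      using ab(2) ac c(2) by (auto simp: doubleton_eq_iff)
  qed
  then have "card Q \<le> card {{a, b}, {b, c}, {a, c}}" by (intro card_mono) auto
  also have "\<dots> \<le> 3" by (simp add: card_insert_if)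
  finally show False using assms(2) by simp
qed

lemma perturbed_HM_subset:
  assumes "perturbed_HM V k c \<gamma> t G" "1 \<le> k"
  shows "G \<subseteq> [V]\<^bsup>k\<^esup>"
proof -
  obtain x E B where "c \<in> V" and xinj: "inj_on x {1..\<gamma>}" and xV: "x ` {1..\<gamma>} \<subseteq> V - {c}"
    and E: "E \<in> [V - insert c (x ` {1..\<gamma>})]\<^bsup>(k - 1)\<^esup>"
    and B: "\<forall>j\<in>{1..\<gamma>}. B j \<subseteq> {S \<in> [V]\<^bsup>k\<^esup>. S \<inter> E = {} \<and> insert c (x ` {1..\<gamma>}) - S = {x j}} \<and> card (B j) = t - 1"
    and G: "G = {S \<in> [V]\<^bsup>k\<^esup>. c \<in> S \<and> (\<forall>j\<in>{1..\<gamma>}. S \<inter> insert (x j) E \<noteq> {})}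
       \<union> (\<lambda>j. insert (x j) E) ` {1..\<gamma>} \<union> (\<Union>j\<in>{1..\<gamma>}. B j)"
    using assms(1) unfolding perturbed_HM_def by (elim exE conjE) (rule that)
  have E': "E \<subseteq> V" "finite E" "card E = k - 1" "E \<inter> x ` {1..\<gamma>} = {}" using E by (auto simp: nsets_def)
  have 1: "insert (x j) E \<in> [V]\<^bsup>k\<^esup>" if "j \<in> {1..\<gamma>}" for j
  proof -
    have "x j \<notin> E" "x j \<in> V" using E'(4) xV that by blast+
    then show ?thesis using E' assms(2) by (simp add: nsets_def)
  qed
  have 2: "B j \<subseteq> [V]\<^bsup>k\<^esup>" if "j \<in> {1..\<gamma>}" for j
    using bspec[OF B that, THEN conjunct1] by (rule order_trans) (rule Collect_subset)
  show ?thesis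
    unfolding G
    by (intro Un_least UN_least image_subsetI 1 2 Collect_subset)
qed

text \<open>The pieces are disjoint: the first kind contains \<open>c\<close> and meets every
  \<open>insert (x j) E\<close>, the sets \<open>insert (x j) E\<close> avoid \<open>c\<close>, and
  a member of \<open>B j\<close> contains \<open>c\<close> but misses \<open>insert (x j) E\<close>.
  Among the points of \<open>x\<close> it misses only \<open>x j\<close>, which keeps the families
  \<open>B j\<close> apart.\<close>

lemma card_perturbed_HM:
  assumes "finite V" "perturbed_HM V k c \<gamma> t G" "2 \<le> k" "\<gamma> < k" "1 \<le> t"
  shows "card G = hm_bound (card V) k \<gamma> t"
proof -
  obtain x E B where c: "c \<in> V" and xinj: "inj_on x {1..\<gamma>}" and xV: "x ` {1..\<gamma>} \<subseteq> V - {c}"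
    and E: "E \<in> [V - insert c (x ` {1..\<gamma>})]\<^bsup>(k - 1)\<^esup>"
    and B': "\<forall>j\<in>{1..\<gamma>}. B j \<subseteq> {S \<in> [V]\<^bsup>k\<^esup>. S \<inter> E = {} \<and> insert c (x ` {1..\<gamma>}) - S = {x j}} \<and> card (B j) = t - 1"
    and G: "G = {S \<in> [V]\<^bsup>k\<^esup>. c \<in> S \<and> (\<forall>j\<in>{1..\<gamma>}. S \<inter> insert (x j) E \<noteq> {})}
       \<union> (\<lambda>j. insert (x j) E) ` {1..\<gamma>} \<union> (\<Union>j\<in>{1..\<gamma>}. B j)"
    using assms(2) unfolding perturbed_HM_def by (elim exE conjE) (rule that)
  have B: "B j \<subseteq> {S \<in> [V]\<^bsup>k\<^esup>. S \<inter> E = {} \<and> insert c (x ` {1..\<gamma>}) - S = {x j}}"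
    and cB: "card (B j) = t - 1" if "j \<in> {1..\<gamma>}" for j
    using B' that by simp_all
  let ?H = "{S \<in> [V]\<^bsup>k\<^esup>. c \<in> S \<and> (\<forall>x\<in>x ` {1..\<gamma>}. S \<inter> insert x E \<noteq> {})}"
  have E': "c \<notin> E" "E \<inter> x ` {1..\<gamma>} = {}" "E \<noteq> {}" using E assms(3) by (auto simp: nsets_def)
  have xc: "x j \<noteq> c" if "j \<in> {1..\<gamma>}" for j using xV that by blast
  have finS: "finite ([V]\<^bsup>k\<^esup>)" using assms(1) by (rule finite_imp_finite_nsets)
  have finB: "finite (B j)" if "j \<in> {1..\<gamma>}" for j
    by (rule finite_subset[OF B[OF that]]) (simp add: finS)
  have cx: "card (x ` {1..\<gamma>}) = \<gamma>" using xinj by (simp add: card_image)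
  have cH: "card ?H = ((card V - 1) choose (k - 1)) - ((card V - k) choose (k - 1))
      + ((card V - k - \<gamma>) choose (k - 1 - \<gamma>))"
    using card_nsets_point_hit_all[OF assms(1) c xV E] cx assms(4) by simp
  have Ainj: "inj_on (\<lambda>j. insert (x j) E) {1..\<gamma>}"
  proof (rule inj_onI)
    fix i j assume ij: "i \<in> {1..\<gamma>}" "j \<in> {1..\<gamma>}" "insert (x i) E = insert (x j) E"
    have "x i \<notin> E" using E'(2) ij(1) by blast
    then have "x i = x j" using ij(3) by blast
    then show "i = j" using xinj ij by (meson inj_onD)
  qed
  have cA: "card ((\<lambda>j. insert (x j) E) ` {1..\<gamma>}) = \<gamma>" using card_image[OF Ainj] by simp
  have Bmem: "c \<in> S \<and> S \<inter> E = {} \<and> x j \<notin> S \<and> (\<forall>i\<in>{1..\<gamma>}. x i \<noteq> x j \<longrightarrow> x i \<in> S)"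
    if S: "S \<in> B j" and j: "j \<in> {1..\<gamma>}" for S j
  proof -
    have SE: "S \<inter> E = {}" and eq: "insert c (x ` {1..\<gamma>}) - S = {x j}" using B[OF j] S by auto
    have mem: "y \<in> insert c (x ` {1..\<gamma>}) - S \<longleftrightarrow> y = x j" for y by (simp only: eq singleton_iff)
    have "c \<in> S" using mem[of c] xc[OF j] by simp
    moreover have "x j \<notin> S" using mem[of "x j"] by simp
    moreover have "x i \<in> S" if "i \<in> {1..\<gamma>}" "x i \<noteq> x j" for i using mem[of "x i"] that by simp
    ultimately show ?thesis using SE by simp
  qed
  have Bdisj: "B i \<inter> B j = {}" if "i \<in> {1..\<gamma>}" "j \<in> {1..\<gamma>}" "i \<noteq> j" for i j
  proof -
    have "x i \<noteq> x j" using xinj that by (meson inj_onD)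
    then show ?thesis using Bmem that by blast
  qed
  have "card (\<Union>j\<in>{1..\<gamma>}. B j) = (\<Sum>j\<in>{1..\<gamma>}. card (B j))"
    using finB Bdisj by (intro card_UN_disjoint) auto
  then have cBU: "card (\<Union>j\<in>{1..\<gamma>}. B j) = \<gamma> * (t - 1)" using cB by simp
  have HA: "?H \<inter> (\<lambda>j. insert (x j) E) ` {1..\<gamma>} = {}"
  proof -
    have "c \<notin> insert (x j) E" if "j \<in> {1..\<gamma>}" for j using xc[OF that] E'(1) by auto
    then show ?thesis by blast
  qed
  have HAB: "(?H \<union> (\<lambda>j. insert (x j) E) ` {1..\<gamma>}) \<inter> (\<Union>j\<in>{1..\<gamma>}. B j) = {}"
  proof -
    have "S \<notin> ?H \<and> S \<notin> (\<lambda>j. insert (x j) E) ` {1..\<gamma>}" if "j \<in> {1..\<gamma>}" "S \<in> B j" for j S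
    proof
      show "S \<notin> ?H" using Bmem[OF that(2,1)] that(1) by auto
      show "S \<notin> (\<lambda>j. insert (x j) E) ` {1..\<gamma>}" using Bmem[OF that(2,1)] E'(3) by auto
    qed
    then show ?thesis by blast
  qed
  have "card G = card (?H \<union> (\<lambda>j. insert (x j) E) ` {1..\<gamma>} \<union> (\<Union>j\<in>{1..\<gamma>}. B j))"
    unfolding G by (simp only: ball_simps)
  also have "\<dots> = card (?H \<union> (\<lambda>j. insert (x j) E) ` {1..\<gamma>}) + card (\<Union>j\<in>{1..\<gamma>}. B j)"
    using finS finB HAB by (intro card_Un_disjoint) simp_all
  also have "card (?H \<union> (\<lambda>j. insert (x j) E) ` {1..\<gamma>}) = card ?H + \<gamma>"
    using card_Un_disjoint[OF _ _ HA] finS cA by simp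
  finally have "card G = card ?H + \<gamma> + \<gamma> * (t - 1)" unfolding cBU .
  moreover have "\<gamma> + \<gamma> * (t - 1) = \<gamma> * t" using assms(5) by (cases t) auto
  ultimately show ?thesis unfolding hm_bound_def cH by linarith
qed

section \<open>Transport along permutations, and splitting off the centres
  \<open>1, ..., r - 1\<close>\<close>

lemma image_nsets_bij:
  assumes "bij \<pi>"
  shows "(`) \<pi> ` {S \<in> [V]\<^bsup>k\<^esup>. P (\<pi> ` S)} = {S \<in> [\<pi> ` V]\<^bsup>k\<^esup>. P S}"
proof
  have inj: "inj_on \<pi> S" for S using assms by (metis bij_is_inj inj_on_subset subset_UNIV)
  show "(`) \<pi> ` {S \<in> [V]\<^bsup>k\<^esup>. P (\<pi> ` S)} \<subseteq> {S \<in> [\<pi> ` V]\<^bsup>k\<^esup>. P S}"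
    using inj by (auto simp: nsets_def card_image)
  show "{S \<in> [\<pi> ` V]\<^bsup>k\<^esup>. P S} \<subseteq> (`) \<pi> ` {S \<in> [V]\<^bsup>k\<^esup>. P (\<pi> ` S)}"
  proof
    fix S assume S: "S \<in> {S \<in> [\<pi> ` V]\<^bsup>k\<^esup>. P S}"
    then obtain T where T: "T \<subseteq> V" "S = \<pi> ` T" by (auto simp: nsets_def subset_image_iff)
    then have "finite T" "card T = k" using S inj[of T] by (auto simp: nsets_def card_image finite_image_iff)
    then show "S \<in> (`) \<pi> ` {S \<in> [V]\<^bsup>k\<^esup>. P (\<pi> ` S)}" using T S by (auto simp: nsets_def)
  qed
qed

text \<open>Serves to move an arbitrary centre, and the popular elements, to the positions
  \<open>r\<close> and \<open>{1..r - 1}\<close> that the extremal families prescribe.\<close>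

lemma perturbed_HM_image:
  assumes "bij \<pi>" "perturbed_HM V k c \<gamma> t G"
  shows "perturbed_HM (\<pi> ` V) k (\<pi> c) \<gamma> t ((`) \<pi> ` G)"
proof -
  have inj: "inj \<pi>" using assms(1) by (rule bij_is_inj)
  obtain x E B where c: "c \<in> V" and xinj: "inj_on x {1..\<gamma>}" and xV: "x ` {1..\<gamma>} \<subseteq> V - {c}"
    and E: "E \<in> [V - insert c (x ` {1..\<gamma>})]\<^bsup>(k - 1)\<^esup>"
    and B': "\<forall>j\<in>{1..\<gamma>}. B j \<subseteq> {S \<in> [V]\<^bsup>k\<^esup>. S \<inter> E = {} \<and> insert c (x ` {1..\<gamma>}) - S = {x j}} \<and> card (B j) = t - 1"
    and G: "G = {S \<in> [V]\<^bsup>k\<^esup>. c \<in> S \<and> (\<forall>j\<in>{1..\<gamma>}. S \<inter> insert (x j) E \<noteq> {})}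
       \<union> (\<lambda>j. insert (x j) E) ` {1..\<gamma>} \<union> (\<Union>j\<in>{1..\<gamma>}. B j)"
    using assms(2) unfolding perturbed_HM_def by (elim exE conjE) (rule that)
  have B: "B j \<subseteq> {S \<in> [V]\<^bsup>k\<^esup>. S \<inter> E = {} \<and> insert c (x ` {1..\<gamma>}) - S = {x j}}"
    and cB: "card (B j) = t - 1" if "j \<in> {1..\<gamma>}" for j
    using B' that by simp_all
  let ?x = "\<pi> \<circ> x" and ?E = "\<pi> ` E" and ?B = "\<lambda>j. (`) \<pi> ` B j"
  have img: "insert (\<pi> c) (?x ` {1..\<gamma>}) = \<pi> ` insert c (x ` {1..\<gamma>})" by (simp add: image_comp)
  have meet: "\<pi> ` S \<inter> \<pi> ` T = {} \<longleftrightarrow> S \<inter> T = {}" for S T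
    using image_Int[OF inj, of S T] by (metis image_is_empty)
  have P1: "\<pi> ` S \<inter> insert (?x j) ?E \<noteq> {} \<longleftrightarrow> S \<inter> insert (x j) E \<noteq> {}" for S j
    using meet[of S "insert (x j) E"] by simp
  have P2: "\<pi> c \<in> \<pi> ` S \<longleftrightarrow> c \<in> S" for S using inj by (simp add: inj_image_mem_iff)
  show ?thesis
    unfolding perturbed_HM_def
  proof (rule exI[of _ ?x], rule exI[of _ ?E], rule exI[of _ ?B], intro conjI)
    show "\<pi> c \<in> \<pi> ` V" using c by blast
    show "inj_on ?x {1..\<gamma>}" using xinj inj by (meson comp_inj_on inj_on_subset subset_UNIV)
    show "?x ` {1..\<gamma>} \<subseteq> \<pi> ` V - {\<pi> c}" using xV inj by (auto dest: injD)
    have "\<pi> ` V - insert (\<pi> c) (?x ` {1..\<gamma>}) = \<pi> ` (V - insert c (x ` {1..\<gamma>}))"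
      unfolding img using inj by (rule image_set_diff[symmetric])
    then show "?E \<in> [\<pi> ` V - insert (\<pi> c) (?x ` {1..\<gamma>})]\<^bsup>(k - 1)\<^esup>"
      using E card_image[OF inj_on_subset[OF inj], of E] by (auto simp: nsets_def)
    show "\<forall>j\<in>{1..\<gamma>}. ?B j \<subseteq> {S \<in> [\<pi> ` V]\<^bsup>k\<^esup>. S \<inter> ?E = {} \<and> insert (\<pi> c) (?x ` {1..\<gamma>}) - S = {?x j}} \<and> card (?B j) = t - 1"
    proof
      fix j assume j: "j \<in> {1..\<gamma>}"
      let ?T = "{S \<in> [V]\<^bsup>k\<^esup>. \<pi> ` S \<inter> ?E = {} \<and> insert (\<pi> c) (?x ` {1..\<gamma>}) - \<pi> ` S = {?x j}}"
      have "B j \<subseteq> ?T"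
      proof
        fix S assume "S \<in> B j"
        then have S: "S \<in> [V]\<^bsup>k\<^esup>" "S \<inter> E = {}" "insert c (x ` {1..\<gamma>}) - S = {x j}"
          using subsetD[OF B[OF j], of S] by simp_all
        have "insert (\<pi> c) (?x ` {1..\<gamma>}) - \<pi> ` S = {?x j}"
          unfolding img image_set_diff[OF inj, symmetric] S(3) by simp
        then show "S \<in> ?T" using S(1,2) meet[of S E] by (intro CollectI conjI) simp_all
      qed
      then have "?B j \<subseteq> (`) \<pi> ` ?T" by (rule image_mono)
      also have "\<dots> = {S \<in> [\<pi> ` V]\<^bsup>k\<^esup>. S \<inter> ?E = {} \<and> insert (\<pi> c) (?x ` {1..\<gamma>}) - S = {?x j}}"
        by (rule image_nsets_bij[OF assms(1)])
      finally have "?B j \<subseteq> {S \<in> [\<pi> ` V]\<^bsup>k\<^esup>. S \<inter> ?E = {} \<and> insert (\<pi> c) (?x ` {1..\<gamma>}) - S = {?x j}}" .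
      moreover have "inj_on ((`) \<pi>) (B j)" using inj by (auto intro: inj_onI simp: inj_image_eq_iff)
      ultimately show "?B j \<subseteq> {S \<in> [\<pi> ` V]\<^bsup>k\<^esup>. S \<inter> ?E = {} \<and> insert (\<pi> c) (?x ` {1..\<gamma>}) - S = {?x j}} \<and> card (?B j) = t - 1"
        using cB[OF j] by (simp add: card_image)
    qed
    have "(`) \<pi> ` {S \<in> [V]\<^bsup>k\<^esup>. c \<in> S \<and> (\<forall>j\<in>{1..\<gamma>}. S \<inter> insert (x j) E \<noteq> {})} =
      (`) \<pi> ` {S \<in> [V]\<^bsup>k\<^esup>. \<pi> c \<in> \<pi> ` S \<and> (\<forall>j\<in>{1..\<gamma>}. \<pi> ` S \<inter> insert (?x j) ?E \<noteq> {})}"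
      by (simp only: P1 P2)
    also have "\<dots> = {S \<in> [\<pi> ` V]\<^bsup>k\<^esup>. \<pi> c \<in> S \<and> (\<forall>j\<in>{1..\<gamma>}. S \<inter> insert (?x j) ?E \<noteq> {})}"
      by (rule image_nsets_bij[OF assms(1)])
    finally show "(`) \<pi> ` G = {S \<in> [\<pi> ` V]\<^bsup>k\<^esup>. \<pi> c \<in> S \<and> (\<forall>j\<in>{1..\<gamma>}. S \<inter> insert (?x j) ?E \<noteq> {})}
       \<union> (\<lambda>j. insert (?x j) ?E) ` {1..\<gamma>} \<union> (\<Union>j\<in>{1..\<gamma>}. ?B j)"
      unfolding G by (simp only: image_Un image_UN image_image image_insert comp_apply)
  qed
qed

text \<open>The complements of \<open>A\<close> and \<open>B\<close> in the finite set
  \<open>S\<close> have equal size, so any bijection between them completes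
  \<open>f\<close>.\<close>

lemma permutes_extending:
  assumes "finite S" "A \<subseteq> S" "B \<subseteq> S" "bij_betw f A B"
  shows "\<exists>\<pi>. \<pi> permutes S \<and> (\<forall>x\<in>A. \<pi> x = f x)"
proof -
  have fin: "finite A" "finite B" using assms finite_subset by blast+
  have "card (S - A) = card (S - B)"
    using assms fin bij_betw_same_card[OF assms(4)] by (simp add: card_Diff_subset)
  then obtain g where g: "bij_betw g (S - A) (S - B)"
    using assms(1) finite_same_card_bij by blast
  let ?h = "\<lambda>x. if x \<in> A then f x else g x"
  have "bij_betw ?h (A \<union> (S - A)) (B \<union> (S - B))"
  proof (rule bij_betw_combine)
    show "bij_betw ?h A B" using assms(4) by (subst bij_betw_cong[of _ _ f]) auto
    show "bij_betw ?h (S - A) (S - B)" using g by (subst bij_betw_cong[of _ _ g]) auto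
  qed auto
  moreover have "A \<union> (S - A) = S" "B \<union> (S - B) = S" using assms by auto
  ultimately have h: "bij_betw ?h S S" by simp
  let ?p = "\<lambda>x. if x \<in> S then ?h x else x"
  have "bij_betw ?p S S" using h by (subst bij_betw_cong[of _ _ ?h]) auto
  then have "?p permutes S" by (rule bij_imp_permutes) auto
  moreover have "\<forall>x\<in>A. ?p x = f x" using assms(2) by auto
  ultimately show ?thesis by blast
qed

text \<open>The stars of \<open>1, ..., r - 1\<close> form all \<open>k\<close>-sets that meet
  \<open>{1..r - 1}\<close>, and everything else lives on the remaining points. In particular,
  requiring \<open>J - S\<close> to be \<open>insert (x j) {1..r - 1}\<close> amounts to
  \<open>S\<close> avoiding \<open>{1..r - 1}\<close> and missing exactly \<open>x j\<close> among
  \<open>r\<close> and the points of \<open>x\<close>.\<close>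

lemma is_J_family_iff:
  assumes "1 \<le> r" "r \<le> n"
  shows "is_J_family n k r \<gamma> t \<G> \<longleftrightarrow>
    (\<exists>G. perturbed_HM ({1..n} - {1..r - 1}) k r \<gamma> t G \<and>
       \<G> = {S \<in> [{1..n}]\<^bsup>k\<^esup>. S \<inter> {1..r - 1} \<noteq> {}} \<union> G)"
    (is "?L \<longleftrightarrow> ?R")
proof -
  let ?P = "{1..r - 1}" and ?V = "{1..n} - {1..r - 1}"
  have ins: "{1..r} = insert r ?P" "r \<notin> ?P" using assms(1) by auto
  have cP: "card {1..r} = r" by simp
  have stars: "(\<Union>l\<in>{1..r - 1}. star n k l) = {S \<in> [{1..n}]\<^bsup>k\<^esup>. S \<inter> ?P \<noteq> {}}"
    by (auto simp: star_def)
  have restr: "restricted_star n k r \<gamma> A = {S \<in> [?V]\<^bsup>k\<^esup>. r \<in> S \<and> (\<forall>j\<in>{1..\<gamma>}. S \<inter> A j \<noteq> {})}" for A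
    by (auto simp: restricted_star_def nsets_def)
  have Bset: "{S \<in> [{1..n}]\<^bsup>k\<^esup>. S \<inter> E = {} \<and> ({1..r} \<union> x ` {1..\<gamma>}) - S = insert (x j) ?P} =
      {S \<in> [?V]\<^bsup>k\<^esup>. S \<inter> E = {} \<and> insert r (x ` {1..\<gamma>}) - S = {x j}}"
    if "x ` {1..\<gamma>} \<inter> {1..r} = {}" "j \<in> {1..\<gamma>}" for E :: "nat set" and x :: "nat \<Rightarrow> nat" and j
  proof (rule Collect_cong)
    fix S :: "nat set"
    have xj: "x j \<notin> ?P" using that ins by blast
    have xP: "insert r (x ` {1..\<gamma>}) \<inter> ?P = {}" using that(1) ins by blast
    have J: "{1..r} \<union> x ` {1..\<gamma>} = ?P \<union> insert r (x ` {1..\<gamma>})" using ins(1) by blast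
    have h1: "({1..r} \<union> x ` {1..\<gamma>}) - S = insert (x j) ?P \<longleftrightarrow>
      S \<inter> ?P = {} \<and> insert r (x ` {1..\<gamma>}) - S = {x j}"
      unfolding J
    proof
      assume eq: "?P \<union> insert r (x ` {1..\<gamma>}) - S = insert (x j) ?P"
      have mem: "y \<in> (?P \<union> insert r (x ` {1..\<gamma>})) - S \<longleftrightarrow> y = x j \<or> y \<in> ?P" for y
        by (simp only: eq insert_iff)
      have PS: "y \<notin> S" if "y \<in> ?P" for y using mem[of y] that by (simp only: Diff_iff simp_thms)
      then have "S \<inter> ?P = {}" by blast
      moreover have "y \<in> insert r (x ` {1..\<gamma>}) - S \<longleftrightarrow> y = x j" for y
      proof
        assume y: "y \<in> insert r (x ` {1..\<gamma>}) - S"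
        then have "y \<notin> ?P" using xP by blast
        moreover have "y = x j \<or> y \<in> ?P" using mem[of y] y by (simp only: Diff_iff Un_iff simp_thms)
        ultimately show "y = x j" by (simp only: simp_thms)
      next
        assume y: "y = x j"
        then have "y \<in> (?P \<union> insert r (x ` {1..\<gamma>})) - S" using mem[of y] by (simp only: simp_thms)
        then show "y \<in> insert r (x ` {1..\<gamma>}) - S" using xj y by (simp only: Diff_iff Un_iff simp_thms)
      qed
      then have "insert r (x ` {1..\<gamma>}) - S = {x j}" by blast
      ultimately show "S \<inter> ?P = {} \<and> insert r (x ` {1..\<gamma>}) - S = {x j}" ..
    qed (simp only: Un_Diff, blast)
    have h2: "S \<in> [?V]\<^bsup>k\<^esup> \<longleftrightarrow> S \<in> [{1..n}]\<^bsup>k\<^esup> \<and> S \<inter> ?P = {}"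
      by (auto simp: nsets_def)
    show "(S \<in> [{1..n}]\<^bsup>k\<^esup> \<and> S \<inter> E = {} \<and> ({1..r} \<union> x ` {1..\<gamma>}) - S = insert (x j) ?P) =
      (S \<in> [?V]\<^bsup>k\<^esup> \<and> S \<inter> E = {} \<and> insert r (x ` {1..\<gamma>}) - S = {x j})"
      by (simp only: h1 h2 conj_ac)
  qed
  \<comment> \<open>The union has at most \<open>r + \<gamma>\<close> elements, so attaining this
    size encodes both the injectivity of \<open>x\<close> and the disjointness of its values from
    \<open>{1..r}\<close>.\<close>
  have Jset: "{1..r} \<union> x ` {1..\<gamma>} \<in> [{1..n}]\<^bsup>(r + \<gamma>)\<^esup> \<longleftrightarrow>
      inj_on x {1..\<gamma>} \<and> x ` {1..\<gamma>} \<subseteq> ?V - {r}" (is "?A \<longleftrightarrow> ?B") for x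
  proof
    assume A: ?A
    have le: "card (x ` {1..\<gamma>}) \<le> \<gamma>" using card_image_le[of "{1..\<gamma>}" x] by simp
    have "card ({1..r} \<union> x ` {1..\<gamma>}) + card ({1..r} \<inter> x ` {1..\<gamma>}) = r + card (x ` {1..\<gamma>})"
      using card_Un_Int[of "{1..r}" "x ` {1..\<gamma>}"] by simp
    moreover have "card ({1..r} \<union> x ` {1..\<gamma>}) = r + \<gamma>" using A by (simp add: nsets_def)
    ultimately have c0: "card ({1..r} \<inter> x ` {1..\<gamma>}) = 0" and c1: "card (x ` {1..\<gamma>}) = \<gamma>"
      using le by linarith+
    have dis: "{1..r} \<inter> x ` {1..\<gamma>} = {}" using c0 by (subst (asm) card_0_eq) simp_all
    have "inj_on x {1..\<gamma>}" using c1 by (intro eq_card_imp_inj_on) simp_all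
    moreover have "x ` {1..\<gamma>} \<subseteq> {1..n}" using A by (simp add: nsets_def)
    ultimately show ?B using dis unfolding ins(1) by blast
  next
    assume B: ?B
    then have "{1..r} \<inter> x ` {1..\<gamma>} = {}" using ins(1) by blast
    then have "card ({1..r} \<union> x ` {1..\<gamma>}) = r + \<gamma>"
      using B by (subst card_Un_disjoint) (auto simp: card_image)
    then show ?A using B assms by (auto simp: nsets_def)
  qed
  have Vs: "?V - insert r Y = {1..n} - ({1..r} \<union> Y)" for Y using ins(1) by blast
  have rV: "r \<in> ?V" using assms by auto
  show ?thesis
  proof
    assume ?L
    then obtain x E B where J: "{1..r} \<union> x ` {1..\<gamma>} \<in> [{1..n}]\<^bsup>(r + \<gamma>)\<^esup>"
      and E: "E \<in> [{1..n} - ({1..r} \<union> x ` {1..\<gamma>})]\<^bsup>(k - 1)\<^esup>"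
      and B: "\<forall>j\<in>{1..\<gamma>}. B j \<subseteq> {S \<in> [{1..n}]\<^bsup>k\<^esup>. S \<inter> E = {} \<and> ({1..r} \<union> x ` {1..\<gamma>}) - S = insert (x j) ?P} \<and> card (B j) = t - 1"
      and G: "\<G> = (\<Union>l\<in>{1..r - 1}. star n k l) \<union> restricted_star n k r \<gamma> (\<lambda>j. insert (x j) E)
                \<union> (\<lambda>j. insert (x j) E) ` {1..\<gamma>} \<union> (\<Union>j\<in>{1..\<gamma>}. B j)"
      unfolding is_J_family_def Let_def by (elim exE conjE) (rule that)
    have xx: "inj_on x {1..\<gamma>}" "x ` {1..\<gamma>} \<subseteq> ?V - {r}" using J Jset by blast+
    have dis: "x ` {1..\<gamma>} \<inter> {1..r} = {}" using xx(2) ins(1) by blast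
    let ?G = "{S \<in> [?V]\<^bsup>k\<^esup>. r \<in> S \<and> (\<forall>j\<in>{1..\<gamma>}. S \<inter> insert (x j) E \<noteq> {})}
       \<union> (\<lambda>j. insert (x j) E) ` {1..\<gamma>} \<union> (\<Union>j\<in>{1..\<gamma>}. B j)"
    have "perturbed_HM ?V k r \<gamma> t ?G"
      unfolding perturbed_HM_def
    proof (rule exI[of _ x], rule exI[of _ E], rule exI[of _ B], intro conjI)
      show "E \<in> [?V - insert r (x ` {1..\<gamma>})]\<^bsup>(k - 1)\<^esup>" unfolding Vs by (rule E)
      show "\<forall>j\<in>{1..\<gamma>}. B j \<subseteq> {S \<in> [?V]\<^bsup>k\<^esup>. S \<inter> E = {} \<and> insert r (x ` {1..\<gamma>}) - S = {x j}} \<and> card (B j) = t - 1"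
        using B Bset[OF dis] by simp
      show "r \<in> ?V" "inj_on x {1..\<gamma>}" "x ` {1..\<gamma>} \<subseteq> ?V - {r}" by (rule rV xx)+
    qed (rule refl)
    moreover have "\<G> = {S \<in> [{1..n}]\<^bsup>k\<^esup>. S \<inter> ?P \<noteq> {}} \<union> ?G"
      unfolding G stars restr by (simp only: Un_assoc)
    ultimately show ?R by (intro exI[of _ ?G] conjI)
  next
    assume ?R
    then obtain G where G: "perturbed_HM ?V k r \<gamma> t G" "\<G> = {S \<in> [{1..n}]\<^bsup>k\<^esup>. S \<inter> ?P \<noteq> {}} \<union> G" by blast
    from G(1) obtain x E B where "r \<in> ?V" and xx: "inj_on x {1..\<gamma>}" "x ` {1..\<gamma>} \<subseteq> ?V - {r}"
      and E: "E \<in> [?V - insert r (x ` {1..\<gamma>})]\<^bsup>(k - 1)\<^esup>"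
      and B: "\<forall>j\<in>{1..\<gamma>}. B j \<subseteq> {S \<in> [?V]\<^bsup>k\<^esup>. S \<inter> E = {} \<and> insert r (x ` {1..\<gamma>}) - S = {x j}} \<and> card (B j) = t - 1"
      and G': "G = {S \<in> [?V]\<^bsup>k\<^esup>. r \<in> S \<and> (\<forall>j\<in>{1..\<gamma>}. S \<inter> insert (x j) E \<noteq> {})}
         \<union> (\<lambda>j. insert (x j) E) ` {1..\<gamma>} \<union> (\<Union>j\<in>{1..\<gamma>}. B j)"
      unfolding perturbed_HM_def by (elim exE conjE) (rule that)
    have dis: "x ` {1..\<gamma>} \<inter> {1..r} = {}" using xx(2) ins(1) by blast
    show ?L
      unfolding is_J_family_def Let_def
    proof (rule exI[of _ x], rule exI[of _ E], rule exI[of _ B], intro conjI)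
      show "{1..r} \<union> x ` {1..\<gamma>} \<in> [{1..n}]\<^bsup>(r + \<gamma>)\<^esup>" using xx Jset by blast
      show "E \<in> [{1..n} - ({1..r} \<union> x ` {1..\<gamma>})]\<^bsup>(k - 1)\<^esup>" using E unfolding Vs .
      show "\<forall>j\<in>{1..\<gamma>}. B j \<subseteq> {S \<in> [{1..n}]\<^bsup>k\<^esup>. S \<inter> E = {} \<and> ({1..r} \<union> x ` {1..\<gamma>}) - S = insert (x j) ?P} \<and> card (B j) = t - 1"
        using B Bset[OF dis] by simp
      show "\<G> = (\<Union>l\<in>{1..r - 1}. star n k l) \<union> restricted_star n k r \<gamma> (\<lambda>j. insert (x j) E)
                \<union> (\<lambda>j. insert (x j) E) ` {1..\<gamma>} \<union> (\<Union>j\<in>{1..\<gamma>}. B j)"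
        unfolding stars restr G(2) G' by (simp only: Un_assoc)
    qed
  qed
qed

section \<open>Stability for one centre\<close>

text \<open>
  The case \<open>r = 1\<close>. The numerical assumptions hold for all large \<open>card V\<close>, see
  \<open>eventually_large\<close> below.
\<close>

locale sparse_family =
  fixes V :: "'a set" and k t \<gamma> :: nat and G :: "'a set set"
  assumes finV: "finite V" and GV: "G \<subseteq> [V]\<^bsup>k\<^esup>" and k5: "k \<ge> 5" and g1: "1 \<le> \<gamma>" and gk: "\<gamma> \<le> k - 2"
    and deg: "\<And>A. A \<in> G \<Longrightarrow> card {B \<in> G. A \<inter> B = {}} < t"
    and robust: "\<And>D. D \<subseteq> G \<Longrightarrow> \<forall>A\<in>G - D. \<forall>B\<in>G - D. A \<inter> B \<noteq> {} \<Longrightarrow> \<gamma> \<le> card D"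
    and large1: "((k - 2) * (k - 2) + k * k * (k + t) + (k + 1) * t) * card V ^ (k - 3) < (card V - k) choose (k - 2)"
    and large2: "t * t * k < (card V - k - \<gamma> - 1) choose (k - 1 - \<gamma>)"
    and large3: "2 \<le> k - 1 - \<gamma> \<Longrightarrow> card V < (card V - k - \<gamma>) choose (k - 1 - \<gamma>)"
    and large4: "3 * k \<le> card V"
    and large_G: "hm_bound (card V) k \<gamma> t \<le> card G"
begin

abbreviation "m \<equiv> card V"

section \<open>Heavy pairs and the common centre\<close>

lemma finG: "finite G" using GV finV finite_imp_finite_nsets finite_subset by metis

lemma memG: "A \<in> G \<Longrightarrow> A \<subseteq> V \<and> finite A \<and> card A = k" using GV by (auto simp: nsets_def)

lemma pow_ge1: "1 \<le> m ^ j" using large4 k5 by (cases m) auto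

text \<open>With nothing removed, robustness and \<open>\<gamma> \<ge> 1\<close> yield two disjoint
  members, and \<open>a\<close> lies in at most one of them.\<close>

lemma missing_member: "\<exists>A\<in>G. a \<notin> A"
  using robust[of "{}"] g1 by fastforce

text \<open>A pair can lie in order \<open>m ^ (k - 2)\<close> members, so the threshold is of lower
  order and light pairs are negligible in total. In the constant, \<open>k\<close> pays for the
  members through \<open>Y\<close> that meet a given member disjoint from \<open>Y\<close>, and
  \<open>t\<close> leaves at least \<open>t\<close> that avoid it.\<close>

definition heavy :: "'a set \<Rightarrow> bool" where
  "heavy Y \<longleftrightarrow> Y \<subseteq> V \<and> card Y = 2 \<and> (k + t) * m ^ (k - 3) \<le> card {S \<in> G. Y \<subseteq> S}"

lemma card_avoid_ge:
  assumes "heavy Y" "W \<inter> Y = {}" "finite W"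
  shows "(k + t) * m ^ (k - 3) \<le> card {S \<in> G. Y \<subseteq> S \<and> S \<inter> W = {}} + card W * m ^ (k - 3)"
proof -
  have "{S \<in> G. Y \<subseteq> S} \<subseteq> {S \<in> G. Y \<subseteq> S \<and> S \<inter> W = {}} \<union> {S \<in> [V]\<^bsup>k\<^esup>. Y \<subseteq> S \<and> S \<inter> W \<noteq> {}}"
    using GV by auto
  then have "card {S \<in> G. Y \<subseteq> S} \<le> card ({S \<in> G. Y \<subseteq> S \<and> S \<inter> W = {}} \<union> {S \<in> [V]\<^bsup>k\<^esup>. Y \<subseteq> S \<and> S \<inter> W \<noteq> {}})"
    using finG finite_imp_finite_nsets[OF finV, of k] by (intro card_mono) auto
  also have "\<dots> \<le> card {S \<in> G. Y \<subseteq> S \<and> S \<inter> W = {}} + card {S \<in> [V]\<^bsup>k\<^esup>. Y \<subseteq> S \<and> S \<inter> W \<noteq> {}}"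
    by (rule card_Un_le)
  also have "card {S \<in> [V]\<^bsup>k\<^esup>. Y \<subseteq> S \<and> S \<inter> W \<noteq> {}} \<le> card W * m ^ (k - 3)"
    using card_nsets_contain_hit_le[of V Y W k] assms finV by (simp add: heavy_def numeral_3_eq_3 numeral_2_eq_2)
  finally show ?thesis using assms(1) by (simp add: heavy_def)
qed

text \<open>
  Most members through a heavy pair avoid any fixed disjoint set, so a member disjoint from the
  pair would have degree at least \<open>t\<close>.
\<close>

lemma heavy_meets_member:
  assumes "heavy Y" "A \<in> G"
  shows "A \<inter> Y \<noteq> {}"
proof
  assume "A \<inter> Y = {}"
  then have "(k + t) * m ^ (k - 3) \<le> card {S \<in> G. Y \<subseteq> S \<and> S \<inter> A = {}} + k * m ^ (k - 3)"
    using card_avoid_ge[OF assms(1), of A] memG[OF assms(2)] by simp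
  then have "t * m ^ (k - 3) \<le> card {S \<in> G. Y \<subseteq> S \<and> S \<inter> A = {}}" by (simp add: algebra_simps)
  also have "\<dots> \<le> card {B \<in> G. A \<inter> B = {}}" using finG by (intro card_mono) auto
  also have "\<dots> < t" using assms deg by auto
  finally show False using large4 k5 by simp
qed

text \<open>If the pairs were disjoint, at most \<open>2 * m ^ (k - 3)\<close> members through
  \<open>Y\<close> could meet \<open>Z\<close>, so some member would avoid the heavy pair
  \<open>Z\<close>.\<close>

lemma heavy_meets_heavy:
  assumes "heavy Y" "heavy Z"
  shows "Y \<inter> Z \<noteq> {}"
proof
  assume "Y \<inter> Z = {}"
  moreover have "finite Z" "card Z = 2" using assms(2) finV by (auto simp: heavy_def finite_subset)
  ultimately have "(k + t) * m ^ (k - 3) \<le> card {S \<in> G. Y \<subseteq> S \<and> S \<inter> Z = {}} + 2 * m ^ (k - 3)"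
    using card_avoid_ge[OF assms(1), of Z] by (simp add: Int_commute)
  moreover have "2 * m ^ (k - 3) < (k + t) * m ^ (k - 3)"
    using large4 k5 by (intro mult_strict_right_mono zero_less_power) auto
  ultimately have "card {S \<in> G. Y \<subseteq> S \<and> S \<inter> Z = {}} \<noteq> 0" by linarith
  then have "{S \<in> G. Y \<subseteq> S \<and> S \<inter> Z = {}} \<noteq> {}" by (metis card.empty)
  then obtain S where "S \<in> G" "S \<inter> Z = {}" by blast
  then show False using heavy_meets_member[OF assms(2)] by blast
qed

lemma many_heavy_pairs: "\<exists>Q. finite Q \<and> k - 1 \<le> card Q \<and> (\<forall>Y\<in>Q. heavy Y)"
proof -
  obtain A1 where A1: "A1 \<in> G" using missing_member by blast
  obtain f where f: "\<And>a. f a \<in> G \<and> a \<notin> f a" using missing_member by metis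
  \<comment> \<open>Up to the few members disjoint from \<open>A1\<close> or from some \<open>f a\<close>, every member contains a pair
    \<open>{a, b}\<close> with \<open>a \<in> A1\<close> and \<open>b \<in> f a\<close>; only heavy pairs contribute to the leading term.\<close>
  define Pr where "Pr = (\<Union>a\<in>A1. (\<lambda>b. {a, b}) ` f a)"
  define Q where "Q = {Y \<in> Pr. heavy Y}"
  have fin1: "finite A1" "card A1 = k" and finf: "\<And>a. finite (f a) \<and> card (f a) = k"
    using memG A1 f by auto
  have finPr: "finite Pr" using fin1 finf by (auto simp: Pr_def)
  have "card Pr \<le> (\<Sum>a\<in>A1. card ((\<lambda>b. {a, b}) ` f a))" unfolding Pr_def using fin1 by (intro card_UN_le)
  also have "\<dots> \<le> (\<Sum>a\<in>A1. k)" by (intro sum_mono) (metis card_image_le finf)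
  finally have cPr: "card Pr \<le> k * k" using fin1 by simp
  have Pr2: "Y \<subseteq> V" "card Y = 2" if Y: "Y \<in> Pr" for Y
  proof -
    obtain a b where ab: "Y = {a, b}" "a \<in> A1" "b \<in> f a" using Y by (auto simp: Pr_def)
    then have "a \<noteq> b" using f by metis
    then show "Y \<subseteq> V" "card Y = 2" using ab A1 f memG by auto
  qed
  let ?N = "\<lambda>A. {B \<in> G. A \<inter> B = {}}"
  let ?C = "(m - 2) choose (k - 2)"
  let ?p = "m ^ (k - 3)"
  have cov: "G \<subseteq> ?N A1 \<union> (\<Union>a\<in>A1. ?N (f a)) \<union> (\<Union>Y\<in>Pr. {S \<in> G. Y \<subseteq> S})"
  proof
    fix S assume S: "S \<in> G"
    show "S \<in> ?N A1 \<union> (\<Union>a\<in>A1. ?N (f a)) \<union> (\<Union>Y\<in>Pr. {S \<in> G. Y \<subseteq> S})"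
    proof (cases "A1 \<inter> S = {}")
      case False
      then obtain a where a: "a \<in> A1" "a \<in> S" by auto
      show ?thesis
      proof (cases "f a \<inter> S = {}")
        case False
        then obtain b where "b \<in> f a" "b \<in> S" by auto
        then have "{a, b} \<in> Pr" "{a, b} \<subseteq> S" using a by (auto simp: Pr_def)
        then show ?thesis using S by blast
      qed (use a S in auto)
    qed (use S in auto)
  qed
  have degf: "card (?N (f a)) \<le> t" for a using deg f less_imp_le by metis
  have c1: "card (?N A1 \<union> (\<Union>a\<in>A1. ?N (f a))) \<le> (k + 1) * t"
  proof -
    have "card (?N A1 \<union> (\<Union>a\<in>A1. ?N (f a))) \<le> card (?N A1) + card (\<Union>a\<in>A1. ?N (f a))" by (rule card_Un_le)
    also have "card (\<Union>a\<in>A1. ?N (f a)) \<le> (\<Sum>a\<in>A1. card (?N (f a)))" using fin1 by (intro card_UN_le)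
    also have "\<dots> \<le> (\<Sum>a\<in>A1. t)" by (intro sum_mono degf)
    finally show ?thesis using deg[OF A1] fin1 by simp
  qed
  have QPr: "Q \<subseteq> Pr" by (auto simp: Q_def)
  have heavy_le: "card {S \<in> G. Y \<subseteq> S} \<le> ?C" if "Y \<in> Q" for Y
  proof -
    have Y: "Y \<subseteq> V" "card Y = 2" using that QPr Pr2 by auto
    have "card {S \<in> G. Y \<subseteq> S} \<le> card {S \<in> [V]\<^bsup>k\<^esup>. Y \<subseteq> S \<and> S \<inter> {} = {}}"
      using GV finite_imp_finite_nsets[OF finV, of k] by (intro card_mono) auto
    also have "\<dots> \<le> ?C" using card_nsets_contain_avoid_le[of V Y "{}" k] Y finV by simp
    finally show ?thesis .
  qed
  have light_le: "card {S \<in> G. Y \<subseteq> S} \<le> (k + t) * ?p" if "Y \<in> Pr - Q" for Y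
    using that Pr2[of Y] by (auto simp: Q_def heavy_def not_le)
  have "card (\<Union>Y\<in>Pr. {S \<in> G. Y \<subseteq> S}) \<le> (\<Sum>Y\<in>Pr. card {S \<in> G. Y \<subseteq> S})" using finPr by (intro card_UN_le)
  also have "\<dots> = (\<Sum>Y\<in>Q. card {S \<in> G. Y \<subseteq> S}) + (\<Sum>Y\<in>Pr - Q. card {S \<in> G. Y \<subseteq> S})"
    using sum.subset_diff[OF QPr finPr] by (simp add: add.commute)
  also have "(\<Sum>Y\<in>Q. card {S \<in> G. Y \<subseteq> S}) \<le> card Q * ?C"
    using sum_bounded_above[of Q "\<lambda>Y. card {S \<in> G. Y \<subseteq> S}" ?C] heavy_le by simp
  also have "(\<Sum>Y\<in>Pr - Q. card {S \<in> G. Y \<subseteq> S}) \<le> card (Pr - Q) * ((k + t) * ?p)"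
    using sum_bounded_above[of "Pr - Q" "\<lambda>Y. card {S \<in> G. Y \<subseteq> S}" "(k + t) * ?p"] light_le by simp
  also have "card (Pr - Q) * ((k + t) * ?p) \<le> (k * k) * ((k + t) * ?p)"
    using cPr card_mono[OF finPr, of "Pr - Q"] by (intro mult_right_mono) auto
  finally have c2: "card (\<Union>Y\<in>Pr. {S \<in> G. Y \<subseteq> S}) \<le> card Q * ?C + k * k * ((k + t) * ?p)" by simp
  have "card G \<le> card (?N A1 \<union> (\<Union>a\<in>A1. ?N (f a)) \<union> (\<Union>Y\<in>Pr. {S \<in> G. Y \<subseteq> S}))"
    using cov fin1 finPr finG by (intro card_mono) auto
  also have "\<dots> \<le> (k + 1) * t + (card Q * ?C + k * k * ((k + t) * ?p))"
    using card_Un_le c1 c2 by (meson add_mono le_trans)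
  finally have up: "card G \<le> (k + 1) * t + (card Q * ?C + k * k * ((k + t) * ?p))" .
  define k' where "k' = k - 3"
  have k': "k = k' + 3" using k5 by (simp add: k'_def)
  define M where "M = m - k"
  have mM: "m = M + k" using large4 by (simp add: M_def)
  \<comment> \<open>Both estimates of \<open>card G\<close> are to be compared in terms of
    \<open>M choose (k - 2)\<close>; passing from \<open>m - 2\<close> to \<open>M\<close> costs
    only lower order.\<close>
  have C_le: "?C \<le> (M choose (k - 2)) + (k - 2) * ?p"
  proof -
    have e: "k - 2 = Suc k'" "k - 3 = k'" "m - 2 = M + (k - 2)" using mM k' by auto
    have "(k - 2) * (M + (k - 2)) ^ k' \<le> (k - 2) * m ^ k'"
      using mM by (intro mult_left_mono power_mono) auto
    then show ?thesis
      using binomial_diff_upper[of M "k - 2" k'] by (simp only: e)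
  qed
  \<comment> \<open>Since \<open>m - 1 = M + (k - 1)\<close>, the difference of binomials in
    \<open>hm_bound\<close> contains \<open>k - 1\<close> copies of
    \<open>M choose (k - 2)\<close>.\<close>
  have low: "(k - 1) * (M choose (k - 2)) \<le> card G"
  proof -
    have "(M choose Suc (Suc k')) + (k - 1) * (M choose Suc k') \<le> (M + (k - 1)) choose Suc (Suc k')"
      by (rule binomial_diff_lower)
    then have "(k - 1) * (M choose (k - 2)) \<le> ((m - 1) choose (k - 1)) - ((m - k) choose (k - 1))"
      using mM k' by simp
    then show ?thesis using large_G by (simp add: hm_bound_def)
  qed
  have "k - 1 \<le> card Q"
  proof (rule ccontr)
    assume "\<not> k - 1 \<le> card Q"
    then have "card Q \<le> k - 2" by simp
    then have "card Q * ?C \<le> (k - 2) * ((M choose (k - 2)) + (k - 2) * ?p)"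
      using C_le by (intro mult_mono) auto
    then have "card G \<le> (k + 1) * t + (k - 2) * (M choose (k - 2)) + (k - 2) * (k - 2) * ?p + k * k * (k + t) * ?p"
      using up by (simp add: algebra_simps)
    also have "(k + 1) * t \<le> (k + 1) * t * ?p" using pow_ge1[of "k - 3"] by simp
    finally have "card G \<le> (k - 2) * (M choose (k - 2)) + ((k - 2) * (k - 2) + k * k * (k + t) + (k + 1) * t) * ?p"
      by (simp add: algebra_simps)
    \<comment> \<open>The three summands of the constant in \<open>large1\<close> come from
      replacing \<open>m - 2\<close> by \<open>M\<close> for at most \<open>k - 2\<close> heavy
      pairs, from at most \<open>k * k\<close> light pairs, and from the members disjoint from
      \<open>A1\<close> or from some \<open>f a\<close>.\<close>
    also have "\<dots> < (k - 2) * (M choose (k - 2)) + (M choose (k - 2))" using large1 by (simp add: M_def)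
    also have "\<dots> = (k - 1) * (M choose (k - 2))" using k' by simp
    finally show False using low by simp
  qed
  moreover have "finite Q" using QPr finPr finite_subset by blast
  ultimately show ?thesis by (auto simp: Q_def)
qed

text \<open>The heavy pairs share a point \<open>c\<close>, and \<open>E\<close> collects
  \<open>k - 1\<close> of their other ends. A member that avoids \<open>c\<close> can meet the heavy
  pair \<open>{c, e}\<close> only in \<open>e\<close>.\<close>

lemma star_structure:
  obtains c E where "c \<in> V" "E \<in> [V - {c}]\<^bsup>(k - 1)\<^esup>" "\<And>A. A \<in> G \<Longrightarrow> c \<notin> A \<Longrightarrow> E \<subseteq> A"
proof -
  obtain Q where Q: "finite Q" "k - 1 \<le> card Q" "\<And>Y. Y \<in> Q \<Longrightarrow> heavy Y" using many_heavy_pairs by blast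
  have Q2: "card Y = 2" "Y \<subseteq> V" if "Y \<in> Q" for Y using Q(3)[OF that] by (auto simp: heavy_def)
  have "\<exists>c. \<forall>Y\<in>Q. c \<in> Y"
    using Q k5 Q2 heavy_meets_heavy by (intro pairwise_meeting_pairs_star) auto
  then obtain c where c: "\<And>Y. Y \<in> Q \<Longrightarrow> c \<in> Y" by blast
  define E' where "E' = {e. e \<noteq> c \<and> {c, e} \<in> Q}"
  have QE: "Q \<subseteq> (\<lambda>e. {c, e}) ` E'"
  proof
    fix Y assume Y: "Y \<in> Q"
    then obtain e where "Y = {c, e}" "e \<noteq> c" using Q2(1)[OF Y] c[OF Y] by (auto simp: card_2_iff)
    then show "Y \<in> (\<lambda>e. {c, e}) ` E'" using Y by (auto simp: E'_def)
  qed
  have E'V: "E' \<subseteq> V - {c}" using Q2 by (auto simp: E'_def)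
  have finE': "finite E'" using E'V finV by (meson finite_Diff finite_subset)
  have "card Q \<le> card E'" using QE finE' surj_card_le by blast
  then obtain E where E: "E \<subseteq> E'" "card E = k - 1" "finite E"
    using Q(2) obtain_subset_with_card_n[of "k - 1" E'] by (metis le_trans)
  have "E \<in> [V - {c}]\<^bsup>(k - 1)\<^esup>" using E E'V by (auto simp: nsets_def)
  moreover have "E \<subseteq> A" if "A \<in> G" "c \<notin> A" for A
  proof
    fix e assume "e \<in> E"
    then have "heavy {c, e}" using E Q by (auto simp: E'_def)
    then show "e \<in> A" using heavy_meets_member[of "{c, e}" A] that by auto
  qed
  moreover have "c \<in> V"
  proof -
    obtain Y where "Y \<in> Q" using Q(2) k5 by fastforce
    then show ?thesis using c Q2 by blast
  qed
  ultimately show thesis using that by blast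
qed

text \<open>A member through \<open>c\<close> either meets every \<open>insert x E\<close> or is
  disjoint from one of them, and each \<open>x\<close> allows at most \<open>t - 1\<close> of the
  latter. When exactly \<open>\<gamma>\<close> members avoid \<open>c\<close>, these upper bounds
  add up to \<open>hm_bound\<close>; the assumed size then turns every estimate into an equality,
  and the equalities dictate the structure.\<close>

lemma perturbed_HM_structure: "card G = hm_bound m k \<gamma> t \<and> (\<exists>c. perturbed_HM V k c \<gamma> t G)"
proof -
  obtain c E where c: "c \<in> V" and E: "E \<in> [V - {c}]\<^bsup>(k - 1)\<^esup>"
    and Esub: "\<And>A. A \<in> G \<Longrightarrow> c \<notin> A \<Longrightarrow> E \<subseteq> A"
    by (rule star_structure) blast
  have E': "E \<subseteq> V" "c \<notin> E" "card E = k - 1" "finite E" using E by (auto simp: nsets_def)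
  have Ene: "E \<noteq> {}" using E'(3) k5 by auto
  define X where "X = {x. x \<noteq> c \<and> x \<notin> E \<and> insert x E \<in> G}"
  have XV: "X \<subseteq> V - insert c E" using memG by (fastforce simp: X_def)
  have finX: "finite X" using XV finV by (meson finite_Diff finite_subset)
  have injX: "inj_on (\<lambda>x. insert x E) X" by (auto simp: inj_on_def X_def)
  have nonc: "{A \<in> G. c \<notin> A} = (\<lambda>x. insert x E) ` X"
  proof
    show "{A \<in> G. c \<notin> A} \<subseteq> (\<lambda>x. insert x E) ` X"
    proof
      fix A assume A: "A \<in> {A \<in> G. c \<notin> A}"
      then have EA: "E \<subseteq> A" and kA: "card A = k" "finite A" using Esub memG by auto
      then have "card (A - E) = 1" using E' k5 by (simp add: card_Diff_subset)
      then obtain x where x: "A - E = {x}" by (auto simp: card_1_singleton_iff)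
      then have "A = insert x E" "x \<notin> E" using EA by auto
      then show "A \<in> (\<lambda>x. insert x E) ` X" using A by (auto simp: X_def)
    qed
  qed (use E' in \<open>auto simp: X_def\<close>)
  define q where "q = card X"
  have cnonc: "card {A \<in> G. c \<notin> A} = q" using nonc injX by (simp add: card_image q_def)
  \<comment> \<open>All other members share \<open>c\<close>, so deleting those that avoid
    \<open>c\<close> leaves an intersecting family.\<close>
  have q_ge: "\<gamma> \<le> q"
  proof -
    have "\<gamma> \<le> card {A \<in> G. c \<notin> A}" by (rule robust) auto
    then show ?thesis using cnonc by simp
  qed
  define N where "N = (\<lambda>x. {B \<in> G. insert x E \<inter> B = {}})"
  have finN: "finite (N x)" for x using finG by (simp add: N_def)
  have cN: "card (N x) \<le> t - 1" if "x \<in> X" for x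
    using deg[of "insert x E"] that by (simp add: X_def N_def)
  have NC: "c \<in> B" if "B \<in> N x" for x B
    using that Esub[of B] Ene by (auto simp: N_def)
  define Gc where "Gc = {A \<in> G. c \<in> A}"
  have finGc: "finite Gc" using finG by (simp add: Gc_def)
  have cG: "card G = q + card Gc"
  proof -
    have "G = {A \<in> G. c \<notin> A} \<union> Gc" by (auto simp: Gc_def)
    moreover have "card ({A \<in> G. c \<notin> A} \<union> Gc) = card {A \<in> G. c \<notin> A} + card Gc"
      using finG by (intro card_Un_disjoint) (auto simp: Gc_def)
    ultimately show ?thesis using cnonc by simp
  qed
  \<comment> \<open>\<open>G\<close> contains a disjoint pair, so some degree is at least 1, and all
    degrees are below \<open>t\<close>.\<close>
  have t2: "t \<ge> 2"
  proof -
    obtain A B where AB: "A \<in> G" "B \<in> G" "A \<inter> B = {}" using robust[of "{}"] g1 by fastforce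
    then have "card {B \<in> G. A \<inter> B = {}} \<noteq> 0" using finG by auto
    then show ?thesis using deg[OF AB(1)] by linarith
  qed
  let ?hit = "{S \<in> [V]\<^bsup>k\<^esup>. c \<in> S \<and> S \<inter> E \<noteq> {}}"
  define h1 where "h1 = ((m - 1) choose (k - 1)) - ((m - k) choose (k - 1))"
  define n' where "n' = m - k - \<gamma>"
  define j where "j = k - 1 - \<gamma>"
  have j1: "j \<ge> 1" using gk k5 by (simp add: j_def)
  have n1: "n' \<ge> 1" using large4 gk k5 by (simp add: n'_def)
  have chit: "card ?hit = h1"
    unfolding h1_def using finV c E k5 by (intro card_nsets_point_hit) auto
  have hm: "hm_bound m k \<gamma> t = h1 + (n' choose j) + \<gamma> * t"
    by (simp add: hm_bound_def h1_def n'_def j_def)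
  have finS: "finite ([V]\<^bsup>k\<^esup>)" using finV by (rule finite_imp_finite_nsets)
  have cUN: "card (\<Union>x\<in>X. N x) \<le> q * (t - 1)"
  proof -
    have "card (\<Union>x\<in>X. N x) \<le> (\<Sum>x\<in>X. card (N x))" using finX by (rule card_UN_le)
    also have "\<dots> \<le> (\<Sum>x\<in>X. t - 1)" by (intro sum_mono cN)
    finally show ?thesis by (simp add: q_def)
  qed
  have "q = \<gamma>"
  proof (rule ccontr)
    assume "q \<noteq> \<gamma>"
    then have q_gt: "\<gamma> + 1 \<le> q" using q_ge by simp
    show False
    \<comment> \<open>For \<open>q \<le> t k\<close> the lost term \<open>(n' - 1) choose j\<close> outweighs the at most \<open>q t\<close> exceptional sets;
      for larger \<open>q\<close>, \<open>t\<close> members through \<open>c\<close> that avoid \<open>E\<close> would also avoid some \<open>x \<in> X\<close>,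
      so \<open>insert x E\<close> would have degree at least \<open>t\<close>.\<close>
    proof (cases "q \<le> t * k")
      case True
      obtain X' where X': "X' \<subseteq> X" "card X' = \<gamma> + 1" "finite X'"
        using q_gt obtain_subset_with_card_n unfolding q_def by metis
      have cX': "card (insert c X') = \<gamma> + 2"
        using X' XV by (subst card_insert_disjoint) auto
      let ?full = "{S \<in> [V]\<^bsup>k\<^esup>. insert c X' \<subseteq> S \<and> S \<inter> E = {}}"
      have "Gc \<subseteq> ?hit \<union> ?full \<union> (\<Union>x\<in>X. N x)"
        using GV X'(1) by (auto simp: Gc_def N_def)
      then have "card Gc \<le> card (?hit \<union> ?full \<union> (\<Union>x\<in>X. N x))"
        using finS finX finN by (intro card_mono) auto
      also have "\<dots> \<le> card ?hit + card ?full + card (\<Union>x\<in>X. N x)"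
        by (meson add_le_mono1 card_Un_le le_trans)
      finally have 1: "card Gc \<le> h1 + card ?full + q * (t - 1)" using cUN chit by linarith
      have "card ?full \<le> (m - card (insert c X') - card E) choose (k - card (insert c X'))"
        using X' XV E' c finV by (intro card_nsets_contain_avoid_le) auto
      also have "m - card (insert c X') - card E = n' - 1"
        using cX' E'(3) k5 by (simp add: n'_def)
      also have "k - card (insert c X') = j - 1" using cX' by (simp add: j_def)
      finally have 2: "card ?full \<le> (n' - 1) choose (j - 1)" .
      \<comment> \<open>The first summand bounds \<open>?full\<close>; the second counts what the
        extra point of \<open>X'\<close> excludes. This slack has to exceed \<open>q * t\<close>,
        which is at most \<open>t * t * k\<close>.\<close>
      have 3: "n' choose j = ((n' - 1) choose (j - 1)) + ((n' - 1) choose j)"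
        using j1 n1 by (cases n'; cases j) auto
      have "q + q * (t - 1) = q * t" using t2 by (cases t) auto
      also have "\<dots> \<le> (t * k) * t" using True by (rule mult_right_mono) simp
      also have "\<dots> < (n' - 1) choose j" using large2 by (simp add: n'_def j_def ac_simps)
      finally have "card G < h1 + (n' choose j)" using 1 2 3 cG by linarith
      then show False using large_G hm by linarith
    next
      case False
      let ?Bs = "{A \<in> Gc. A \<inter> E = {}}"
      have "card ?Bs < t"
      proof (rule ccontr)
        assume "\<not> card ?Bs < t"
        then have "t \<le> card ?Bs" by (rule leI)
        then obtain T where T: "T \<subseteq> ?Bs" "card T = t" "finite T"
          by (rule obtain_subset_with_card_n)
        have TG: "T \<subseteq> G" using T by (auto simp: Gc_def)
        have "card (\<Union>T) \<le> (\<Sum>A\<in>T. card A)" using card_Union_le_sum_card[of T] by blast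
        also have "\<dots> = (\<Sum>A\<in>T. k)" using TG memG by (intro sum.cong) auto
        finally have "card (\<Union>T) < card X" using False T(2) by (simp add: q_def)
        moreover have "finite (\<Union>T)" using TG memG T by (intro finite_Union) auto
        ultimately obtain x where x: "x \<in> X" "x \<notin> \<Union>T"
          by (meson card_mono not_less subsetI)
        have "T \<subseteq> N x" using x(2) T TG by (auto simp: N_def)
        then have "t \<le> card (N x)" using T(2) finN card_mono by metis
        then show False using cN[OF x(1)] t2 by linarith
      qed
      moreover have "Gc \<subseteq> ?hit \<union> ?Bs" using GV by (auto simp: Gc_def)
      then have "card Gc \<le> card (?hit \<union> ?Bs)" using finS finGc by (intro card_mono) auto
      then have "card Gc \<le> h1 + card ?Bs" using card_Un_le[of ?hit ?Bs] chit by linarith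
      moreover have "q \<le> m - k"
      proof -
        have "q \<le> card (V - insert c E)" unfolding q_def using XV finV by (intro card_mono) auto
        also have "\<dots> = m - k" using E' c k5 finV by (subst card_Diff_subset) auto
        finally show ?thesis .
      qed
      ultimately have up: "card G + 1 \<le> h1 + (m - k) + t" using cG by linarith
      have tg: "t \<le> \<gamma> * t" using g1 by simp
      show False
      proof (cases "j \<ge> 2")
        case True
        then have "m < n' choose j" using large3 by (simp add: n'_def j_def)
        then show False using up large_G hm tg by linarith
      next
        case False
        \<comment> \<open>Here \<open>\<gamma> = k - 2\<close>, so \<open>n' choose j\<close> is
          only linear in \<open>m\<close> and does not by itself outweigh up to \<open>m - k\<close>
          members avoiding \<open>c\<close>. Constants decide: \<open>\<gamma> \<ge> 3\<close> and
          \<open>t \<ge> 2\<close> give \<open>\<gamma> + t \<le> \<gamma> * t\<close>.\<close>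
        then have jj: "j = 1" using j1 by simp
        then have "n' choose j = m - k - \<gamma>" by (simp add: n'_def)
        moreover have "\<gamma> \<ge> 3" using jj k5 by (simp add: j_def)
        then obtain g where g: "\<gamma> = g + 3" by (metis add.commute le_Suc_ex)
        obtain u where u: "t = u + 2" using t2 by (metis add.commute le_Suc_ex)
        have "\<gamma> + t \<le> \<gamma> * t" by (simp add: g u algebra_simps)
        ultimately show False using up large_G hm large4 gk by linarith
      qed
    qed
  qed
  then have q: "card X = \<gamma>" by (simp add: q_def)
  let ?H = "{S \<in> [V]\<^bsup>k\<^esup>. c \<in> S \<and> (\<forall>x\<in>X. S \<inter> insert x E \<noteq> {})}"
  have cH: "card ?H = h1 + (n' choose j)"
    unfolding h1_def n'_def j_def q[symmetric]
    using finV c XV E gk k5 q by (intro card_nsets_point_hit_all) (auto simp: nsets_def)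
  have Gc_eq: "Gc = (G \<inter> ?H) \<union> (\<Union>x\<in>X. N x)"
    using GV NC by (auto simp: Gc_def N_def)
  have cGc: "card Gc \<le> card (G \<inter> ?H) + card (\<Union>x\<in>X. N x)" unfolding Gc_eq by (rule card_Un_le)
  have cGH: "card (G \<inter> ?H) \<le> card ?H" using finS by (intro card_mono) auto
  have gt: "\<gamma> + \<gamma> * (t - 1) = \<gamma> * t" using t2 by (cases t) auto
  have q': "q = \<gamma>" by (simp add: q q_def)
  have tot: "h1 + (n' choose j) + \<gamma> * (t - 1) \<le> card Gc"
    using large_G hm cG gt q' by linarith
  \<comment> \<open>The lower bound \<open>tot\<close> for \<open>card Gc\<close> equals the sum of
    the upper bounds for its two parts, so both are attained.\<close>
  have eqs: "card (G \<inter> ?H) = card ?H" "card (\<Union>x\<in>X. N x) = \<gamma> * (t - 1)"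
    using tot cGc cGH cH cUN q' by auto
  have HG: "?H \<subseteq> G"
    using card_subset_eq[of ?H "G \<inter> ?H"] eqs(1) finS by auto
  have cardG: "card G = hm_bound m k \<gamma> t" using tot cGc eqs cH hm cG q' gt by linarith
  have cNeq: "card (N x) = t - 1" if x: "x \<in> X" for x
  proof (rule ccontr)
    assume "card (N x) \<noteq> t - 1"
    then have "card (N x) < t - 1" using cN[OF x] by simp
    then have "(\<Sum>x\<in>X. card (N x)) < (\<Sum>x\<in>X. t - 1)"
      using x finX cN by (intro sum_strict_mono_ex1) auto
    then show False using card_UN_le[OF finX, of N] eqs(2) q by simp
  qed
  have disj: "N x \<inter> N y = {}" if xy: "x \<in> X" "y \<in> X" "x \<noteq> y" for x y
  proof (rule ccontr)
    assume "N x \<inter> N y \<noteq> {}"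
    then obtain B where B: "B \<in> N x" "B \<in> N y" by blast
    \<comment> \<open>Dropping \<open>B\<close> from \<open>N x\<close> keeps the union, because
      \<open>B\<close> remains in \<open>N y\<close>, but pushes the sum of the sizes below
      \<open>\<gamma> * (t - 1)\<close>.\<close>
    let ?N' = "N(x := N x - {B})"
    have "(\<Union>z\<in>X. N z) \<subseteq> (\<Union>z\<in>X. ?N' z)"
      using B xy by auto
    then have "card (\<Union>z\<in>X. N z) \<le> card (\<Union>z\<in>X. ?N' z)"
      using finX finN by (intro card_mono) auto
    also have "\<dots> \<le> (\<Sum>z\<in>X. card (?N' z))" using finX by (rule card_UN_le)
    also have "\<dots> < (\<Sum>z\<in>X. t - 1)"
      using finX xy B cNeq t2 finN by (intro sum_strict_mono_ex1) (auto simp: card_Diff_singleton)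
    finally show False using eqs(2) q by simp
  qed
  have "finite X" "card {1..\<gamma>} = card X" using finX q by auto
  then obtain x where x: "bij_betw x {1..\<gamma>} X" using finite_same_card_bij[of "{1..\<gamma>}" X] by auto
  have xX: "x ` {1..\<gamma>} = X" and xinj: "inj_on x {1..\<gamma>}" using x by (auto simp: bij_betw_def)
  have "perturbed_HM V k c \<gamma> t G"
    unfolding perturbed_HM_def
  proof (rule exI[of _ x], rule exI[of _ E], rule exI[of _ "N \<circ> x"], intro conjI)
    show "c \<in> V" "inj_on x {1..\<gamma>}" by fact+
    show "x ` {1..\<gamma>} \<subseteq> V - {c}" using xX XV by auto
    show "E \<in> [V - insert c (x ` {1..\<gamma>})]\<^bsup>(k - 1)\<^esup>" using xX XV E by (auto simp: nsets_def)
    show "\<forall>i\<in>{1..\<gamma>}. (N \<circ> x) i \<subseteq> {S \<in> [V]\<^bsup>k\<^esup>. S \<inter> E = {} \<and> insert c (x ` {1..\<gamma>}) - S = {x i}} \<and> card ((N \<circ> x) i) = t - 1"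
    proof (intro ballI conjI subsetI)
      fix i assume i: "i \<in> {1..\<gamma>}"
      then have xi: "x i \<in> X" using xX by blast
      then show "card ((N \<circ> x) i) = t - 1" using cNeq by simp
      fix S assume S: "S \<in> (N \<circ> x) i"
      then have SG: "S \<in> G" "x i \<notin> S" "S \<inter> E = {}" "c \<in> S" using NC by (auto simp: N_def)
      \<comment> \<open>\<open>S\<close> already misses \<open>E\<close>, so missing a second point
        \<open>y\<close> of \<open>X\<close> would put it into \<open>N y\<close> as well.\<close>
      have "y \<in> S" if y: "y \<in> X" "y \<noteq> x i" for y
      proof -
        have "S \<notin> N y" using disj[OF y(1) xi y(2)] S by auto
        then show ?thesis using SG by (auto simp: N_def)
      qed
      then have "insert c X - S = {x i}" using SG xi by auto
      then show "S \<in> {S \<in> [V]\<^bsup>k\<^esup>. S \<inter> E = {} \<and> insert c (x ` {1..\<gamma>}) - S = {x i}}"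
        using SG GV xX by auto
    qed
    have "G = Gc \<union> {A \<in> G. c \<notin> A}" by (auto simp: Gc_def)
    also have "\<dots> = ?H \<union> (\<Union>x\<in>X. N x) \<union> (\<lambda>x. insert x E) ` X" unfolding Gc_eq nonc using HG by blast
    finally show "G = {S \<in> [V]\<^bsup>k\<^esup>. c \<in> S \<and> (\<forall>j\<in>{1..\<gamma>}. S \<inter> insert (x j) E \<noteq> {})}
       \<union> (\<lambda>j. insert (x j) E) ` {1..\<gamma>} \<union> (\<Union>j\<in>{1..\<gamma>}. (N \<circ> x) j)"
      unfolding xX[symmetric] by (simp add: image_image Un_ac)
  qed
  then show ?thesis using cardG by blast
qed

end

section \<open>Popular elements and forbidden subgraphs\<close>

text \<open>Each part is sent bijectively onto its \<open>Q i\<close>. Different parts receive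
  different sets, since members are nonempty and disjoint across parts. Within a part nothing is
  required, because the subgraph need not be induced.\<close>

lemma contains_complete_multipartiteI:
  assumes F: "F \<subseteq> [{1..n}]\<^bsup>k\<^esup>"
    and Q: "\<And>i. i < length ss \<Longrightarrow> Q i \<subseteq> F \<and> finite (Q i) \<and> card (Q i) = ss ! i"
    and cross: "\<And>i j A B. i < length ss \<Longrightarrow> j < length ss \<Longrightarrow> i \<noteq> j \<Longrightarrow> A \<in> Q i \<Longrightarrow> B \<in> Q j \<Longrightarrow> A \<inter> B = {}"
    and k: "k \<ge> 1"
  shows "contains_subgraph (with_proj (kneser_graph n k) \<restriction> F) (with_proj (complete_multipartite ss))"
proof -
  have "\<forall>i. \<exists>h. i < length ss \<longrightarrow> bij_betw h {..<ss ! i} (Q i)"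
    using Q by (metis card_lessThan finite_lessThan finite_same_card_bij)
  then obtain e where e: "\<And>i. i < length ss \<Longrightarrow> bij_betw (e i) {..<ss ! i} (Q i)" by metis
  define f where "f = (\<lambda>u. e (fst u) (snd u))"
  define V where "V = (SIGMA i:{..<length ss}. {..<ss ! i})"
  have fQ: "f u \<in> Q (fst u)" "fst u < length ss" if "u \<in> V" for u
    using that bij_betwE[OF e, of "fst u"] by (auto simp: f_def V_def)
  have fdisj: "f u \<inter> f v = {}" if "u \<in> V" "v \<in> V" "fst u \<noteq> fst v" for u v
    using cross fQ that by blast
  have ne: "A \<noteq> {}" if "A \<in> F" for A using that F k by (auto simp: nsets_def)
  have inj: "inj_on f V"
  proof (rule inj_onI)
    fix u v assume uv: "u \<in> V" "v \<in> V" "f u = f v"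
    have "f u \<in> F" using fQ uv(1) Q by blast
    then have "fst u = fst v" using fdisj[OF uv(1,2)] uv(3) ne by fastforce
    moreover have "snd u = snd v"
      using bij_betw_imp_inj_on[OF e, of "fst u"] uv calculation by (auto simp: V_def f_def inj_on_def)
    ultimately show "u = v" by (simp add: prod_eq_iff)
  qed
  have vs: "verts (with_proj (complete_multipartite ss)) = V"
    and as: "arcs (with_proj (complete_multipartite ss)) = {(u, v). u \<in> V \<and> v \<in> V \<and> fst u \<noteq> fst v}"
    by (auto simp: complete_multipartite_def V_def Let_def)
  \<comment> \<open>Arcs are vertex pairs in both graphs, so \<open>map_prod f f\<close> carries
    them over and \<open>fst\<close> and \<open>snd\<close> stay tail and head; this makes the image
    compatible with the Kneser graph.\<close>
  define hom where "hom = \<lparr>iso_verts = f, iso_arcs = map_prod f f,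
    iso_head = (snd :: nat set \<times> nat set \<Rightarrow> nat set), iso_tail = fst\<rparr>"
  have iso: "pre_digraph.digraph_isomorphism (with_proj (complete_multipartite ss)) hom"
    unfolding pre_digraph.digraph_isomorphism_def
  proof (intro conjI)
    show "wf_digraph (with_proj (complete_multipartite ss))"
      by unfold_locales (auto simp: complete_multipartite_def Let_def)
    show "inj_on (iso_verts hom) (verts (with_proj (complete_multipartite ss)))"
      using inj by (simp only: vs) (simp add: hom_def)
    show "inj_on (iso_arcs hom) (arcs (with_proj (complete_multipartite ss)))"
      unfolding as using map_prod_inj_on[OF inj inj]
      by (simp only: hom_def digraph_isomorphism.simps) (rule inj_on_subset, assumption, blast)
    show "\<forall>a\<in>arcs (with_proj (complete_multipartite ss)).
      iso_verts hom (tail (with_proj (complete_multipartite ss)) a) = iso_tail hom (iso_arcs hom a) \<and>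
      iso_verts hom (head (with_proj (complete_multipartite ss)) a) = iso_head hom (iso_arcs hom a)"
      by (simp only: with_proj_simps hom_def digraph_isomorphism.simps fst_map_prod snd_map_prod simp_thms ball_triv)
  qed
  have fF: "f u \<in> F" if "u \<in> V" for u using fQ[OF that] Q by blast
  have "subgraph (app_iso hom (with_proj (complete_multipartite ss))) (with_proj (kneser_graph n k) \<restriction> F)"
    unfolding subgraph_def
  proof (intro conjI)
    show "verts (app_iso hom (with_proj (complete_multipartite ss))) \<subseteq> verts (with_proj (kneser_graph n k) \<restriction> F)"
      unfolding verts_app_iso vs using fF by (simp add: hom_def image_subset_iff)
    show "arcs (app_iso hom (with_proj (complete_multipartite ss))) \<subseteq> arcs (with_proj (kneser_graph n k) \<restriction> F)"
    proof
      fix a assume "a \<in> arcs (app_iso hom (with_proj (complete_multipartite ss)))"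
      then obtain u v where uv: "u \<in> V" "v \<in> V" "fst u \<noteq> fst v" "a = (f u, f v)"
        unfolding arcs_app_iso as by (auto simp: hom_def)
      have "f u \<in> F" "f v \<in> F" using fF uv by blast+
      then show "a \<in> arcs (with_proj (kneser_graph n k) \<restriction> F)"
        using F fdisj uv by (auto simp: kneser_graph_def)
    qed
    show "wf_digraph (with_proj (kneser_graph n k) \<restriction> F)"
      by unfold_locales auto
    show "wf_digraph (app_iso hom (with_proj (complete_multipartite ss)))"
    proof
      fix a assume "a \<in> arcs (app_iso hom (with_proj (complete_multipartite ss)))"
      then obtain u v where uv: "u \<in> V" "v \<in> V" "a = (f u, f v)"
        unfolding arcs_app_iso as by (auto simp: hom_def)
      then show "tail (app_iso hom (with_proj (complete_multipartite ss))) a \<in> verts (app_iso hom (with_proj (complete_multipartite ss)))"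
        and "head (app_iso hom (with_proj (complete_multipartite ss))) a \<in> verts (app_iso hom (with_proj (complete_multipartite ss)))"
        unfolding verts_app_iso vs tail_app_iso head_app_iso by (auto simp: hom_def)
    qed
    show "compatible (with_proj (kneser_graph n k) \<restriction> F) (app_iso hom (with_proj (complete_multipartite ss)))"
      by (simp add: compatible_def hom_def)
  qed
  then show ?thesis using iso unfolding contains_subgraph_def digraph_iso_def by blast
qed

text \<open>The elements of \<open>M\<close> are labelled by the vertices of the complete
  multipartite graph, and each part takes its own labels.\<close>

lemma disjoint_parts_of_card:
  assumes "finite M" "card M = sum_list ss"
  obtains Q where "\<And>i. i < length ss \<Longrightarrow> Q i \<subseteq> M \<and> card (Q i) = ss ! i"
    and "\<And>i j. i < length ss \<Longrightarrow> j < length ss \<Longrightarrow> i \<noteq> j \<Longrightarrow> Q i \<inter> Q j = {}"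
proof -
  define V where "V = (SIGMA i:{..<length ss}. {..<ss ! i})"
  have "card V = card M"
    using assms by (simp add: V_def sum_list_sum_nth atLeast0LessThan)
  moreover have "finite V" by (simp add: V_def)
  ultimately obtain h where h: "bij_betw h V M" using assms finite_same_card_bij by blast
  define Q where "Q = (\<lambda>i. h ` ({i} \<times> {..<ss ! i}))"
  have sub: "{i} \<times> {..<ss ! i} \<subseteq> V" if "i < length ss" for i using that by (auto simp: V_def)
  have "Q i \<subseteq> M \<and> card (Q i) = ss ! i" if "i < length ss" for i
  proof
    show "Q i \<subseteq> M" using h sub[OF that] by (auto simp: Q_def bij_betw_def)
    have "inj_on h ({i} \<times> {..<ss ! i})" using h sub[OF that] inj_on_subset by (auto simp: bij_betw_def)
    then show "card (Q i) = ss ! i" by (simp add: Q_def card_image)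
  qed
  moreover have "Q i \<inter> Q j = {}" if "i < length ss" "j < length ss" "i \<noteq> j" for i j
  proof -
    have "Q i \<inter> Q j = h ` ({i} \<times> {..<ss ! i} \<inter> {j} \<times> {..<ss ! j})"
      unfolding Q_def using h sub that by (intro inj_on_image_Int[symmetric, of h V]) (auto simp: bij_betw_def)
    then show ?thesis using that by auto
  qed
  ultimately show thesis using that by blast
qed

text \<open>Greedy choice: \<open>M\<close> disjoint members cover at most \<open>M * k\<close>
  points, and at most \<open>M * k * D\<close> members meet these.\<close>

lemma exists_matching:
  assumes "finite V" "F \<subseteq> [V]\<^bsup>k\<^esup>" "k \<ge> 1"
    and deg: "\<And>i. i \<in> V \<Longrightarrow> card {S \<in> F. i \<in> S} \<le> D"
    and "M * (k * D) < card F"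
  shows "\<exists>N\<subseteq>F. card N = M \<and> finite N \<and> (\<forall>A\<in>N. \<forall>B\<in>N. A \<noteq> B \<longrightarrow> A \<inter> B = {})"
  using assms(5)
proof (induction M)
  case 0
  then show ?case by (intro exI[of _ "{}"]) auto
next
  case (Suc M)
  have finF: "finite F" using assms finite_imp_finite_nsets finite_subset by blast
  from Suc obtain N where N: "N \<subseteq> F" "card N = M" "finite N" "\<forall>A\<in>N. \<forall>B\<in>N. A \<noteq> B \<longrightarrow> A \<inter> B = {}"
    by auto
  have cU: "card (\<Union>N) \<le> M * k"
  proof -
    have "card (\<Union>N) \<le> (\<Sum>A\<in>N. card A)" using N(3) card_Union_le_sum_card[of N] by blast
    also have "\<dots> = (\<Sum>A\<in>N. k)" using N assms by (intro sum.cong) (auto simp: nsets_def)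
    finally show ?thesis using N by simp
  qed
  have UV: "\<Union>N \<subseteq> V" using N assms by (auto simp: nsets_def)
  have fU: "finite (\<Union>N)" using UV assms finite_subset by blast
  have "card {S \<in> F. S \<inter> \<Union>N \<noteq> {}} \<le> card (\<Union>i\<in>\<Union>N. {S \<in> F. i \<in> S})"
    using fU finF by (intro card_mono finite_UN_I) auto
  also have "\<dots> \<le> (\<Sum>i\<in>\<Union>N. card {S \<in> F. i \<in> S})" using fU by (intro card_UN_le) auto
  also have "\<dots> \<le> (\<Sum>i\<in>\<Union>N. D)" using UV by (intro sum_mono deg) auto
  also have "\<dots> \<le> M * k * D" using cU by simp
  also have "\<dots> < card F" using Suc.prems by (simp add: algebra_simps)
  finally have "card {S \<in> F. S \<inter> \<Union>N \<noteq> {}} < card F" .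
  moreover have "{S \<in> F. S \<inter> \<Union>N \<noteq> {}} = F" if "\<forall>A\<in>F. A \<inter> \<Union>N \<noteq> {}"
    using that by blast
  ultimately obtain A where A: "A \<in> F" "A \<inter> \<Union>N = {}" by (metis less_irrefl)
  then have "A \<noteq> {}" using assms by (auto simp: nsets_def)
  then have "A \<notin> N" using A by blast
  have AN: "A \<inter> B = {}" if "B \<in> N" for B using A(2) that by blast
  show ?case
  proof (intro exI[of _ "insert A N"] conjI)
    show "\<forall>X\<in>insert A N. \<forall>Y\<in>insert A N. X \<noteq> Y \<longrightarrow> X \<inter> Y = {}"
      using AN N(4) by (metis Int_commute insert_iff)
  qed (use A(1) N \<open>A \<notin> N\<close> in simp_all)
qed

text \<open>Sets are chosen for one element of \<open>P\<close> at a time. Those chosen earlier must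
  avoid the elements still to come, which is why \<open>p\<close> joins \<open>W\<close> in the
  induction. Per element, the budget \<open>T * k + 1\<close> pays for at most \<open>T\<close>
  chosen \<open>k\<close>-sets and for the reserved element itself.\<close>

lemma extend_through_popular:
  assumes "finite V" "card V \<ge> 1" "F \<subseteq> [V]\<^bsup>k\<^esup>"
    and "finite P" "P \<subseteq> V" "finite W" "W \<inter> P = {}"
    and "\<And>p. p \<in> P \<Longrightarrow> C * card V ^ (k - 2) \<le> card {S \<in> F. p \<in> S}"
    and "\<And>p. p \<in> P \<Longrightarrow> \<sigma> p \<le> T"
    and "card W + card P * (T * k + 1) + T \<le> C"
  shows "\<exists>Q. (\<forall>p\<in>P. Q p \<subseteq> {S \<in> F. S \<inter> W = {}} \<and> finite (Q p) \<and> card (Q p) = \<sigma> p)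
    \<and> (\<forall>p\<in>P. \<forall>q\<in>P. p \<noteq> q \<longrightarrow> (\<forall>A\<in>Q p. \<forall>B\<in>Q q. A \<inter> B = {}))"
  using assms(4-)
proof (induction P arbitrary: W rule: finite_induct)
  case empty
  then show ?case by auto
next
  case (insert p P)
  have finF: "finite F" using assms finite_imp_finite_nsets finite_subset by blast
  have "card (insert p W) \<le> card W + 1"
    using insert.prems(2) by (simp add: card_insert_if)
  then have c1: "card (insert p W) + card P * (T * k + 1) + T \<le> C"
    using insert.prems(6) insert.hyps by (simp add: algebra_simps)
  have c2: "insert p W \<inter> P = {}" using insert.prems insert.hyps by auto
  have c3: "P \<subseteq> V" "finite (insert p W)" using insert.prems by auto
  have "\<exists>Q. (\<forall>q\<in>P. Q q \<subseteq> {S \<in> F. S \<inter> insert p W = {}} \<and> finite (Q q) \<and> card (Q q) = \<sigma> q)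
    \<and> (\<forall>q\<in>P. \<forall>q'\<in>P. q \<noteq> q' \<longrightarrow> (\<forall>A\<in>Q q. \<forall>B\<in>Q q'. A \<inter> B = {}))"
  proof (rule insert.IH)
    show "P \<subseteq> V" "finite (insert p W)" "insert p W \<inter> P = {}" by fact+
    show "card (insert p W) + card P * (T * k + 1) + T \<le> C" by fact
  qed (use insert.prems(4,5) in \<open>blast+\<close>)
  then obtain Q where Q: "\<forall>q\<in>P. Q q \<subseteq> {S \<in> F. S \<inter> insert p W = {}} \<and> finite (Q q) \<and> card (Q q) = \<sigma> q"
    "\<forall>q\<in>P. \<forall>q'\<in>P. q \<noteq> q' \<longrightarrow> (\<forall>A\<in>Q q. \<forall>B\<in>Q q'. A \<inter> B = {})"
    by (elim exE conjE) (rule that)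
  \<comment> \<open>Everything the sets through \<open>p\<close> must avoid. The point
    \<open>p\<close> is not in it, since \<open>W\<close> misses it and the earlier sets avoid
    \<open>insert p W\<close>.\<close>
  define Z where "Z = W \<union> (\<Union>p'\<in>P. \<Union>(Q p'))"
  have QF: "Q p' \<subseteq> F" if "p' \<in> P" for p' using Q that by auto
  have SF: "finite S \<and> card S = k" if "S \<in> F" for S using that assms(3) by (auto simp: nsets_def)
  have fU: "finite (\<Union>(Q p'))" if "p' \<in> P" for p'
    using Q(1) that QF SF by (intro finite_Union) blast+
  then have fZ: "finite Z" using insert by (auto simp: Z_def)
  have "card (\<Union>p'\<in>P. \<Union>(Q p')) \<le> (\<Sum>p'\<in>P. card (\<Union>(Q p')))"
    using insert.hyps by (intro card_UN_le)
  also have "\<dots> \<le> (\<Sum>p'\<in>P. T * k)"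
  proof (rule sum_mono)
    fix p' assume p': "p' \<in> P"
    have "card (\<Union>(Q p')) \<le> (\<Sum>A\<in>Q p'. card A)"
      using card_Union_le_sum_card[of "Q p'"] by blast
    also have "\<dots> = (\<Sum>A\<in>Q p'. k)" using QF[OF p'] SF by (intro sum.cong) auto
    also have "\<dots> \<le> T * k" using Q(1) p' insert.prems(5)[of p'] by simp
    finally show "card (\<Union>(Q p')) \<le> T * k" .
  qed
  finally have "card (\<Union>p'\<in>P. \<Union>(Q p')) \<le> card P * (T * k)" by simp
  then have cZ: "card Z \<le> card W + card P * (T * k)"
    unfolding Z_def using card_Un_le[of W "\<Union>p'\<in>P. \<Union>(Q p')"] by linarith
  have pZ: "p \<notin> Z" using insert.prems(3) Q(1) by (auto simp: Z_def)
  have "{S \<in> F. p \<in> S} \<subseteq> {S \<in> F. p \<in> S \<and> S \<inter> Z = {}} \<union> {S \<in> [V]\<^bsup>k\<^esup>. {p} \<subseteq> S \<and> S \<inter> Z \<noteq> {}}"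
    using assms(3) by auto
  then have "card {S \<in> F. p \<in> S} \<le> card ({S \<in> F. p \<in> S \<and> S \<inter> Z = {}} \<union> {S \<in> [V]\<^bsup>k\<^esup>. {p} \<subseteq> S \<and> S \<inter> Z \<noteq> {}})"
    using finF finite_imp_finite_nsets[OF assms(1), of k] by (intro card_mono) auto
  also have "\<dots> \<le> card {S \<in> F. p \<in> S \<and> S \<inter> Z = {}} + card {S \<in> [V]\<^bsup>k\<^esup>. {p} \<subseteq> S \<and> S \<inter> Z \<noteq> {}}"
    by (rule card_Un_le)
  also have "card {S \<in> [V]\<^bsup>k\<^esup>. {p} \<subseteq> S \<and> S \<inter> Z \<noteq> {}} \<le> card Z * card V ^ (k - 2)"
    using card_nsets_contain_hit_le[of V "{p}" Z k] assms(1) insert.prems(1) pZ fZ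
    by (simp add: numeral_2_eq_2)
  finally have "C * card V ^ (k - 2) \<le> card {S \<in> F. p \<in> S \<and> S \<inter> Z = {}} + card Z * card V ^ (k - 2)"
    using insert.prems(4)[of p] by simp
  moreover have "(card Z + T) * card V ^ (k - 2) \<le> C * card V ^ (k - 2)"
    using cZ insert.prems(6) insert.hyps by (intro mult_right_mono) (auto simp: algebra_simps)
  ultimately have "T * card V ^ (k - 2) \<le> card {S \<in> F. p \<in> S \<and> S \<inter> Z = {}}"
    by (simp add: algebra_simps)
  moreover have "T * 1 \<le> T * card V ^ (k - 2)" using assms(2) by (intro mult_left_mono) auto
  moreover have "\<sigma> p \<le> T" using insert.prems(5) by blast
  ultimately have "\<sigma> p \<le> card {S \<in> F. p \<in> S \<and> S \<inter> Z = {}}"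
    by linarith
  then obtain R where R: "R \<subseteq> {S \<in> F. p \<in> S \<and> S \<inter> Z = {}}" "card R = \<sigma> p" "finite R"
    by (rule obtain_subset_with_card_n)
  have RQ: "A \<inter> B = {}" if "A \<in> R" "B \<in> Q q" "q \<in> P" for A B q
    using that R(1) unfolding Z_def by blast
  have pP: "q \<noteq> p" if "q \<in> P" for q using that insert.hyps by auto
  show ?case
  proof (intro exI[of _ "Q(p := R)"] conjI ballI impI)
    fix q assume "q \<in> insert p P"
    then show "(Q(p := R)) q \<subseteq> {S \<in> F. S \<inter> W = {}}" "finite ((Q(p := R)) q)" "card ((Q(p := R)) q) = \<sigma> q"
      using R Q(1) pP by (auto simp: Z_def)
  next
    fix q q' A B assume qq: "q \<in> insert p P" "q' \<in> insert p P" "q \<noteq> q'" "A \<in> (Q(p := R)) q" "B \<in> (Q(p := R)) q'"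
    consider "q = p" "q' \<in> P" "q' \<noteq> p" | "q' = p" "q \<in> P" "q \<noteq> p" | "q \<in> P" "q' \<in> P" "q \<noteq> p" "q' \<noteq> p"
      using qq by auto
    then show "A \<inter> B = {}"
    proof cases
      case 1
      then show ?thesis using qq(4,5) by (intro RQ[of A B q']) simp_all
    next
      case 2
      then have "B \<inter> A = {}" using qq(4,5) by (intro RQ[of B A q]) simp_all
      then show ?thesis by (simp add: Int_commute)
    next
      case 3
      then show ?thesis using qq(3,4,5) by (intro Q(2)[rule_format, of q q']) simp_all
    qed
  qed
qed

section \<open>Reduction to the members that avoid the popular elements\<close>

lemma ell_le_card:
  assumes "D \<subseteq> F" "finite D" "\<not> (\<exists>N\<subseteq>F - D. finite N \<and> card N = q \<and> disjoint N)"
  shows "ell q F \<le> card D"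
  unfolding ell_def by (rule Least_le) (use assms in blast)

text \<open>Among pairwise disjoint members, at most \<open>r - 1\<close> can meet the
  \<open>r - 1\<close> points of \<open>P\<close> and, once \<open>D\<close> is removed, at most one
  avoids \<open>P\<close>. This turns the lower bound on \<open>ell\<close> into the assumption
  \<open>robust\<close> for one centre.\<close>

lemma ell_le_card_away:
  assumes "finite F" "finite P" "card P = r - 1" "1 \<le> r"
    and "D \<subseteq> {S \<in> F. S \<inter> P = {}}"
    and meet: "\<forall>A\<in>{S \<in> F. S \<inter> P = {}} - D. \<forall>B\<in>{S \<in> F. S \<inter> P = {}} - D. A \<inter> B \<noteq> {}"
  shows "ell (r + 1) F \<le> card D"
proof (rule ell_le_card)
  show "D \<subseteq> F" using assms(5) by blast
  show "finite D" using assms(1,5) by (meson \<open>D \<subseteq> F\<close> finite_subset)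
  show "\<not> (\<exists>N\<subseteq>F - D. finite N \<and> card N = r + 1 \<and> disjoint N)"
  proof
    assume "\<exists>N\<subseteq>F - D. finite N \<and> card N = r + 1 \<and> disjoint N"
    then obtain N where N: "N \<subseteq> F - D" "finite N" "card N = r + 1" "disjoint N" by blast
    let ?N1 = "{S \<in> N. S \<inter> P \<noteq> {}}" and ?N2 = "{S \<in> N. S \<inter> P = {}}"
    have "A = B" if "A \<in> ?N2" "B \<in> ?N2" for A B
    proof (rule ccontr)
      assume "A \<noteq> B"
      then have "A \<inter> B = {}" using N(4) that by (simp add: disjoint_def)
      moreover have "A \<inter> B \<noteq> {}" using that N(1) by (intro meet[rule_format]) auto
      ultimately show False by blast
    qed
    then have c2: "card ?N2 \<le> Suc 0" using N(2) card_le_Suc0_iff_eq[of ?N2] by simp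
    define f where "f = (\<lambda>S. SOME p. p \<in> S \<inter> P)"
    have f: "f S \<in> S \<inter> P" if "S \<in> ?N1" for S
    proof -
      have "\<exists>p. p \<in> S \<inter> P" using that by blast
      then show ?thesis unfolding f_def by (rule someI_ex)
    qed
    have "inj_on f ?N1"
    proof (rule inj_onI, rule ccontr)
      fix A B assume AB: "A \<in> ?N1" "B \<in> ?N1" "f A = f B" "A \<noteq> B"
      have "A \<inter> B = {}" using N(4) AB(1,2,4) by (simp add: disjoint_def)
      moreover have "f A \<in> A" "f A \<in> B" using f[OF AB(1)] f[OF AB(2)] AB(3) by simp_all
      ultimately show False by blast
    qed
    moreover have "f ` ?N1 \<subseteq> P" using f by blast
    ultimately have "card ?N1 \<le> card P" using assms(2) card_inj_on_le by blast
    moreover have "card N = card ?N1 + card ?N2"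
    proof -
      have "N = ?N1 \<union> ?N2" by blast
      moreover have "card (?N1 \<union> ?N2) = card ?N1 + card ?N2"
        using N(2) by (intro card_Un_disjoint) auto
      ultimately show ?thesis by argo
    qed
    ultimately show False using c2 N(3) assms(3,4) by linarith
  qed
qed

text \<open>Away from the popular elements all degrees are at most \<open>D\<close>, so a larger
  family contains a matching of \<open>sum_list ss\<close> members. However it is divided into
  parts, a matching yields the complete multipartite graph, because all its members are
  disjoint.\<close>

lemma card_away_from_popular_le:
  assumes F: "F \<subseteq> [{1..n}]\<^bsup>k\<^esup>" and "k \<ge> 1"
    and free: "\<not> contains_subgraph (with_proj (kneser_graph n k) \<restriction> F) (with_proj (complete_multipartite ss))"
  shows "card {S \<in> F. S \<inter> {p \<in> {1..n}. D \<le> card {S \<in> F. p \<in> S}} = {}} \<le> sum_list ss * (k * D)"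
proof (rule ccontr)
  let ?Pop = "{p \<in> {1..n}. D \<le> card {S \<in> F. p \<in> S}}"
  let ?F = "{S \<in> F. S \<inter> ?Pop = {}}"
  assume "\<not> card ?F \<le> sum_list ss * (k * D)"
  then have big: "sum_list ss * (k * D) < card ?F" by simp
  have finF: "finite F" using F finite_imp_finite_nsets[of "{1..n}" k] finite_subset by blast
  have deg: "card {S \<in> ?F. i \<in> S} \<le> D" if "i \<in> {1..n}" for i
  proof (cases "i \<in> ?Pop")
    case True
    then have "{S \<in> ?F. i \<in> S} = {}" by blast
    then show ?thesis by (metis card.empty le0)
  next
    case False
    have "card {S \<in> ?F. i \<in> S} \<le> card {S \<in> F. i \<in> S}" using finF by (intro card_mono) auto
    also have "\<dots> \<le> D" using False that by simp
    finally show ?thesis .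
  qed
  have "?F \<subseteq> [{1..n}]\<^bsup>k\<^esup>" using F by blast
  then have "\<exists>N\<subseteq>?F. card N = sum_list ss \<and> finite N \<and> (\<forall>A\<in>N. \<forall>B\<in>N. A \<noteq> B \<longrightarrow> A \<inter> B = {})"
    by (rule exists_matching[OF finite_atLeastAtMost _ assms(2) deg big])
  then obtain N where N: "N \<subseteq> ?F" "card N = sum_list ss" "finite N" "\<forall>A\<in>N. \<forall>B\<in>N. A \<noteq> B \<longrightarrow> A \<inter> B = {}"
    by (elim exE conjE) (rule that)
  have NF: "N \<subseteq> F" using N(1) by (rule order_trans) (rule Collect_subset)
  obtain Q where Q: "\<And>i. i < length ss \<Longrightarrow> Q i \<subseteq> N \<and> card (Q i) = ss ! i"
    "\<And>i j. i < length ss \<Longrightarrow> j < length ss \<Longrightarrow> i \<noteq> j \<Longrightarrow> Q i \<inter> Q j = {}"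
  proof (rule disjoint_parts_of_card[OF N(3,2)])
    fix Q assume "\<And>i. i < length ss \<Longrightarrow> Q i \<subseteq> N \<and> card (Q i) = ss ! i"
      "\<And>i j. i < length ss \<Longrightarrow> j < length ss \<Longrightarrow> i \<noteq> j \<Longrightarrow> Q i \<inter> Q j = {}"
    then show thesis by (rule that[of Q])
  qed
  have "contains_subgraph (with_proj (kneser_graph n k) \<restriction> F) (with_proj (complete_multipartite ss))"
  proof (rule contains_complete_multipartiteI[OF F _ _ assms(2)])
    fix i assume "i < length ss"
    then show "Q i \<subseteq> F \<and> finite (Q i) \<and> card (Q i) = ss ! i"
      using Q(1)[of i] NF N(3) finite_subset[of "Q i" N] order_trans[of "Q i" N F] by simp
  next
    fix i j A B assume ij: "i < length ss" "j < length ss" "i \<noteq> j" and AB: "A \<in> Q i" "B \<in> Q j"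
    have "A \<noteq> B" using Q(2)[OF ij] AB by blast
    moreover have "A \<in> N" "B \<in> N" using Q(1) ij AB by blast+
    ultimately show "A \<inter> B = {}" using N(4) by blast
  qed
  then show False using free by blast
qed

text \<open>A member \<open>A\<close> with \<open>last s\<close> neighbours, all avoiding
  \<open>P\<close>, supplies the last two parts of the forbidden graph; the other parts are taken
  through the elements of \<open>P\<close>. The summand \<open>(last s + 1) * k\<close> of
  \<open>C\<close> bounds the points of \<open>A\<close> and its neighbours, which those parts must
  avoid.\<close>

lemma degree_away_from_popular_less:
  assumes F: "F \<subseteq> [{1..n}]\<^bsup>k\<^esup>" and "k \<ge> 1" "n \<ge> 1"
    and free: "\<not> contains_subgraph (with_proj (kneser_graph n k) \<restriction> F) (with_proj (complete_multipartite (s @ [1])))"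
    and P: "P \<subseteq> {1..n}" "card P = length s - 1" and s: "s \<noteq> []"
    and pop: "\<And>p. p \<in> P \<Longrightarrow> C * n ^ (k - 2) \<le> card {S \<in> F. p \<in> S}"
    and C: "(last s + 1) * k + card P * (sum_list s * k + 1) + sum_list s \<le> C"
    and A: "A \<in> F" "A \<inter> P = {}"
  shows "card {B \<in> {S \<in> F. S \<inter> P = {}}. A \<inter> B = {}} < last s"
proof (rule ccontr)
  assume "\<not> ?thesis"
  then have "last s \<le> card {B \<in> {S \<in> F. S \<inter> P = {}}. A \<inter> B = {}}" by simp
  then obtain T where T: "T \<subseteq> {B \<in> {S \<in> F. S \<inter> P = {}}. A \<inter> B = {}}" "card T = last s" "finite T"
    by (rule obtain_subset_with_card_n)
  have finP: "finite P" using P(1) finite_subset by blast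
  have SF: "finite S \<and> card S = k" if "S \<in> F" for S using subsetD[OF F that] by (simp add: nsets_def)
  have TF: "T \<subseteq> F" using T(1) by blast
  define W where "W = A \<union> \<Union>T"
  have finW: "finite W" unfolding W_def using SF A(1) TF T(3) by blast
  have "card (\<Union>T) \<le> (\<Sum>S\<in>T. card S)" using card_Union_le_sum_card[of T] by blast
  also have "\<dots> = (\<Sum>S\<in>T. k)" using SF TF by (intro sum.cong) auto
  finally have "card (\<Union>T) \<le> last s * k" using T(2) by simp
  then have cW: "card W \<le> (last s + 1) * k"
    using card_Un_le[of A "\<Union>T"] SF[OF A(1)] by (simp add: W_def)
  have WP: "W \<inter> P = {}" using A(2) T(1) by (auto simp: W_def)
  \<comment> \<open>Matches the elements of \<open>P\<close> with all positions of \<open>s\<close>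
    but the last; the inverse tells which part size belongs to \<open>p\<close>.\<close>
  obtain e where e: "bij_betw e {..<length s - 1} P"
    using finite_same_card_bij[of "{..<length s - 1}" P] finP P(2) by auto
  let ?inv = "inv_into {..<length s - 1} e"
  have inv: "?inv p < length s - 1" if "p \<in> P" for p
    using e that inv_into_into[of p e "{..<length s - 1}"] by (simp add: bij_betw_def)
  have "\<exists>Q. (\<forall>p\<in>P. Q p \<subseteq> {S \<in> F. S \<inter> W = {}} \<and> finite (Q p) \<and> card (Q p) = s ! ?inv p)
    \<and> (\<forall>p\<in>P. \<forall>q\<in>P. p \<noteq> q \<longrightarrow> (\<forall>A\<in>Q p. \<forall>B\<in>Q q. A \<inter> B = {}))"
  proof (rule extend_through_popular[where V = "{1..n}" and k = k and T = "sum_list s" and C = C])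
    show "C * card {1..n} ^ (k - 2) \<le> card {S \<in> F. p \<in> S}" if "p \<in> P" for p using pop[OF that] by simp
    show "s ! ?inv p \<le> sum_list s" if "p \<in> P" for p
      using inv[OF that] by (intro elem_le_sum_list) linarith
    show "card W + card P * (sum_list s * k + 1) + sum_list s \<le> C" using cW C by linarith
  qed (use assms finP finW WP in simp_all)
  then obtain Q where Q: "\<forall>p\<in>P. Q p \<subseteq> {S \<in> F. S \<inter> W = {}} \<and> finite (Q p) \<and> card (Q p) = s ! ?inv p"
    "\<forall>p\<in>P. \<forall>q\<in>P. p \<noteq> q \<longrightarrow> (\<forall>A\<in>Q p. \<forall>B\<in>Q q. A \<inter> B = {})"
    by (elim exE conjE) (rule that)
  \<comment> \<open>The singleton \<open>{A}\<close> is the part for the appended \<open>1\<close>.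
    That \<open>s\<close> is nonempty keeps the truncated index \<open>length s - 1\<close> of
    \<open>T\<close> apart from \<open>length s\<close>.\<close>
  define R where "R = (\<lambda>i. if i < length s - 1 then Q (e i) else if i = length s - 1 then T else {A})"
  have eP: "e i \<in> P" if "i < length s - 1" for i using bij_betwE[OF e] that by simp
  have RQ: "X \<inter> Y = {}" if "i < length s - 1" "X \<in> Q (e i)" "Y \<subseteq> W" for i X Y
    using bspec[OF Q(1) eP[OF that(1)]] that(2,3) by blast
  have cross: "X \<inter> Y = {}" if ij: "i < j" "j < length (s @ [1])" and XY: "X \<in> R i" "Y \<in> R j" for i j X Y
  proof -
    consider "j < length s - 1" | "i < length s - 1" "j \<ge> length s - 1" | "i = length s - 1" "j = length s"
      using ij by fastforce
    then show ?thesis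
    proof cases
      case 1
      then have "e i \<noteq> e j" using e ij(1) by (auto simp: bij_betw_def dest: inj_onD)
      then show ?thesis using Q(2) eP[of i] eP[of j] 1 ij(1) XY by (simp add: R_def)
    next
      case 2
      have "Y \<subseteq> W" using XY(2) 2(2) by (auto simp: R_def W_def split: if_splits)
      then show ?thesis using RQ[OF 2(1), of X Y] XY(1) 2(1) by (simp add: R_def)
    next
      case 3
      have "\<not> length s < length s - 1" "length s \<noteq> length s - 1" using s by (cases s; simp)+
      then have "R (length s) = {A}" unfolding R_def by (simp only: if_False)
      moreover have "R (length s - 1) = T" by (simp add: R_def)
      ultimately have "X \<in> T" "Y = A" using XY 3 by simp_all
      then show ?thesis using T(1) by blast
    qed
  qed
  have "contains_subgraph (with_proj (kneser_graph n k) \<restriction> F) (with_proj (complete_multipartite (s @ [1])))"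
  proof (rule contains_complete_multipartiteI[OF F _ _ assms(2), of _ R])
    fix i assume "i < length (s @ [1])"
    then consider "i < length s - 1" | "i = length s - 1" "i < length s" | "i = length s" by fastforce
    then show "R i \<subseteq> F \<and> finite (R i) \<and> card (R i) = (s @ [1]) ! i"
    proof cases
      case 1
      have "?inv (e i) = i" using e 1 by (simp add: bij_betw_def inv_into_f_f)
      then show ?thesis using bspec[OF Q(1) eP[OF 1]] 1 by (auto simp: R_def nth_append)
    next
      case 2
      then have "(s @ [1]) ! i = last s" using s by (simp add: nth_append last_conv_nth)
      then show ?thesis using 2 TF T(2,3) by (simp add: R_def)
    next
      case 3
      have "\<not> length s < length s - 1" "length s \<noteq> length s - 1" using s by (cases s; simp)+
      then have "R i = {A}" unfolding R_def 3 by (simp only: if_False)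
      then show ?thesis using 3 A(1) by simp
    qed
  next
    fix i j X Y assume "i < length (s @ [1])" "j < length (s @ [1])" "i \<noteq> j" "X \<in> R i" "Y \<in> R j"
    then show "X \<inter> Y = {}" using cross[of i j X Y] cross[of j i Y X] by (metis Int_commute nat_neq_iff)
  qed
  then show False using free by blast
qed

text \<open>With \<open>m = n - (r - 1)\<close>, Pascal's rule turns \<open>(n - r) choose k\<close>
  into \<open>m choose k\<close> minus \<open>(m - 1) choose (k - 1)\<close>. So the bound counts
  the \<open>k\<close>-sets meeting \<open>r - 1\<close> fixed points and adds the extremal size for
  one centre; by monotonicity no difference of binomials on the right truncates.\<close>

lemma int_bound_eq:
  assumes "1 \<le> r" "r + k + \<gamma> \<le> n" "1 \<le> k" "\<gamma> \<le> k - 2"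
  shows "int (n choose k) - int ((n - r) choose k) - int ((n - k - r + 1) choose (k - 1))
      + int ((n - k - r - \<gamma> + 1) choose (k - \<gamma> - 1)) + int (\<gamma> * t)
    = int ((n choose k) - ((n - (r - 1)) choose k) + hm_bound (n - (r - 1)) k \<gamma> t)"
proof -
  define m where "m = n - (r - 1)"
  have e: "n - r = m - 1" "n - k - r + 1 = m - k" "n - k - r - \<gamma> + 1 = m - k - \<gamma>" "k - \<gamma> - 1 = k - 1 - \<gamma>"
    using assms by (auto simp: m_def)
  have "m \<ge> 1" using assms by (simp add: m_def)
  then have pascal: "m choose k = ((m - 1) choose (k - 1)) + ((m - 1) choose k)"
    using assms(3) by (cases m; cases k) auto
  have 1: "m choose k \<le> n choose k" by (rule binomial_right_mono) (simp add: m_def)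
  have 2: "(m - k) choose (k - 1) \<le> (m - 1) choose (k - 1)"
    by (rule binomial_right_mono) (use assms(3) in linarith)
  show ?thesis
    unfolding m_def[symmetric] e hm_bound_def using 1 2 pascal by (simp add: of_nat_diff)
qed

section \<open>The equality case and the conclusion\<close>

lemma card_isomorphic_to_J_family:
  assumes "is_J_family n k r \<gamma> t \<G>" "isomorphic_families n F \<G>"
    and "1 \<le> r" "r \<le> n" "2 \<le> k" "\<gamma> < k" "1 \<le> t"
  shows "card F = (n choose k) - ((n - (r - 1)) choose k) + hm_bound (n - (r - 1)) k \<gamma> t"
proof -
  let ?V = "{1..n} - {1..r - 1}"
  have cV: "card ?V = n - (r - 1)" using assms(3,4) by (subst card_Diff_subset) auto
  obtain G where G: "perturbed_HM ?V k r \<gamma> t G" and eq: "\<G> = {S \<in> [{1..n}]\<^bsup>k\<^esup>. S \<inter> {1..r - 1} \<noteq> {}} \<union> G"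
    using assms(1) unfolding is_J_family_iff[OF assms(3,4)] by (elim exE conjE) (rule that)
  have GV: "G \<subseteq> [?V]\<^bsup>k\<^esup>" using perturbed_HM_subset[OF G] assms(5) by simp
  have finG: "finite G" using GV finite_imp_finite_nsets[of ?V k] finite_subset by blast
  have "{S \<in> [{1..n}]\<^bsup>k\<^esup>. S \<inter> {1..r - 1} \<noteq> {}} \<inter> G = {}" using GV by (auto simp: nsets_def)
  then have "card \<G> = card {S \<in> [{1..n}]\<^bsup>k\<^esup>. S \<inter> {1..r - 1} \<noteq> {}} + card G"
    unfolding eq using finG finite_imp_finite_nsets[of "{1..n}" k] by (intro card_Un_disjoint) simp_all
  moreover have "card {S \<in> [{1..n}]\<^bsup>k\<^esup>. S \<inter> {1..r - 1} \<noteq> {}} = (n choose k) - ((n - (r - 1)) choose k)"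
  proof -
    have "{1..r - 1} \<subseteq> {1..n}" using assms(4) by auto
    from card_nsets_hit[OF finite_atLeastAtMost this, of k] show ?thesis by simp
  qed
  moreover have "card G = hm_bound (n - (r - 1)) k \<gamma> t"
    using card_perturbed_HM[OF _ G assms(5-7)] cV by simp
  moreover obtain \<pi> where \<pi>: "\<pi> permutes {1..n}" "\<G> = (`) \<pi> ` F"
    using assms(2) unfolding isomorphic_families_def by blast
  have "card \<G> = card F"
    unfolding \<pi>(2) using permutes_inj[OF \<pi>(1)] by (intro card_image inj_onI) (simp add: inj_image_eq_iff)
  ultimately show ?thesis by linarith
qed

text \<open>The extremal families prescribe only the positions of \<open>P\<close> and
  \<open>c\<close>, while \<open>x\<close>, \<open>E\<close> and \<open>B\<close> are free. Hence
  any permutation that takes \<open>P\<close> to \<open>{1..r - 1}\<close> and \<open>c\<close> to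
  \<open>r\<close> will do.\<close>

lemma isomorphic_to_J_familyI:
  assumes P: "P \<subseteq> {1..n}" "card P = r - 1" and r: "1 \<le> r" "r \<le> n"
    and G: "perturbed_HM ({1..n} - P) k c \<gamma> t G"
    and F: "F = {S \<in> [{1..n}]\<^bsup>k\<^esup>. S \<inter> P \<noteq> {}} \<union> G"
  shows "\<exists>\<G>. is_J_family n k r \<gamma> t \<G> \<and> isomorphic_families n F \<G>"
proof -
  have finP: "finite P" using P(1) finite_subset by blast
  have c: "c \<in> {1..n} - P" using G unfolding perturbed_HM_def by (elim exE conjE)
  obtain f where f: "bij_betw f P {1..r - 1}"
    using finite_same_card_bij[of P "{1..r - 1}"] finP P(2) by auto
  let ?f = "f(c := r)"
  have bf: "bij_betw ?f (insert c P) (insert r {1..r - 1})"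
  proof -
    have "bij_betw ?f P {1..r - 1}" using f c by (subst bij_betw_cong[of _ _ f]) auto
    moreover have "bij_betw ?f {c} {r}" by simp
    ultimately have "bij_betw ?f (P \<union> {c}) ({1..r - 1} \<union> {r})" using r by (intro bij_betw_combine) auto
    then show ?thesis by simp
  qed
  have "insert c P \<subseteq> {1..n}" "insert r {1..r - 1} \<subseteq> {1..n}" using P(1) c r by auto
  from permutes_extending[OF finite_atLeastAtMost this bf]
  obtain \<pi> where \<pi>: "\<pi> permutes {1..n}" "\<forall>x\<in>insert c P. \<pi> x = ?f x"
    by (elim exE conjE) (rule that)
  have bij: "bij \<pi>" using \<pi>(1) by (rule permutes_bij)
  have \<pi>P: "\<pi> ` P = {1..r - 1}"
  proof -
    have "\<pi> ` P = f ` P" using \<pi>(2) c by (intro image_cong) auto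
    then show ?thesis using f by (simp add: bij_betw_def)
  qed
  have \<pi>n: "\<pi> ` {1..n} = {1..n}" using \<pi>(1) by (rule permutes_image)
  have \<pi>V: "\<pi> ` ({1..n} - P) = {1..n} - {1..r - 1}"
    by (simp only: image_set_diff[OF bij_is_inj[OF bij]] \<pi>P \<pi>n)
  have \<pi>c: "\<pi> c = r" using \<pi>(2) by simp
  have "perturbed_HM ({1..n} - {1..r - 1}) k r \<gamma> t ((`) \<pi> ` G)"
    using perturbed_HM_image[OF bij G] unfolding \<pi>V \<pi>c .
  moreover have "(`) \<pi> ` F = {S \<in> [{1..n}]\<^bsup>k\<^esup>. S \<inter> {1..r - 1} \<noteq> {}} \<union> (`) \<pi> ` G"
  proof -
    have meet: "S \<inter> P \<noteq> {} \<longleftrightarrow> \<pi> ` S \<inter> {1..r - 1} \<noteq> {}" for S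
      unfolding \<pi>P[symmetric] image_Int[OF bij_is_inj[OF bij], symmetric] by simp
    have "(`) \<pi> ` {S \<in> [{1..n}]\<^bsup>k\<^esup>. S \<inter> P \<noteq> {}} = {S \<in> [\<pi> ` {1..n}]\<^bsup>k\<^esup>. S \<inter> {1..r - 1} \<noteq> {}}"
      unfolding meet by (rule image_nsets_bij[OF bij])
    then show ?thesis unfolding F image_Un \<pi>n by simp
  qed
  ultimately have "is_J_family n k r \<gamma> t ((`) \<pi> ` F)"
    unfolding is_J_family_iff[OF r] by blast
  then show ?thesis using \<pi>(1) unfolding isomorphic_families_def by blast
qed

text \<open>At most \<open>r - 2\<close> popular elements would account for at most
  \<open>r - 2\<close> times \<open>(n - 1) choose (k - 1)\<close> members, up to order
  \<open>n ^ (k - 2)\<close> for the rest, whereas the assumed size has leading coefficient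
  \<open>r - 1\<close>.\<close>

lemma many_popular_elements:
  assumes F: "F \<subseteq> [{1..n}]\<^bsup>k\<^esup>" and k: "k \<ge> 2" and r: "1 \<le> r" "r \<le> n"
    and free: "\<not> contains_subgraph (with_proj (kneser_graph n k) \<restriction> F) (with_proj (complete_multipartite ss))"
    and large: "(r * r + sum_list ss * (k * C)) * n ^ (k - 2) < (n - (r - 1)) choose (k - 1)"
    and big: "(n choose k) - ((n - (r - 1)) choose k) \<le> card F"
  shows "r - 1 \<le> card {p \<in> {1..n}. C * n ^ (k - 2) \<le> card {S \<in> F. p \<in> S}}"
proof (rule ccontr)
  let ?Pop = "{p \<in> {1..n}. C * n ^ (k - 2) \<le> card {S \<in> F. p \<in> S}}"
  assume "\<not> r - 1 \<le> card ?Pop"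
  then have few: "card ?Pop + 2 \<le> r" by linarith
  \<comment> \<open>\<open>d\<close> bounds the number of popular elements. Both estimates are
    expressed by \<open>b choose (k - 1)\<close> for \<open>b = n - (r - 1)\<close>, which is
    \<open>n - 1\<close> shifted by \<open>d\<close>.\<close>
  define d where "d = r - 2"
  define k' where "k' = k - 2"
  have d: "r = d + 2" and k': "k = k' + 2" using few k unfolding d_def k'_def by linarith+
  define b where "b = n - (r - 1)"
  have n: "n = b + (d + 1)" using r d by (simp add: b_def)
  have finS: "finite ([{1..n}]\<^bsup>k\<^esup>)" by (simp add: finite_imp_finite_nsets)
  have finF: "finite F" using F finS by (rule finite_subset)
  have PopV: "?Pop \<subseteq> {1..n}" by blast
  have away: "card {S \<in> F. S \<inter> ?Pop = {}} \<le> sum_list ss * (k * (C * n ^ (k - 2)))"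
    using k by (intro card_away_from_popular_le[OF F _ free]) simp
  have "card {S \<in> F. S \<inter> ?Pop \<noteq> {}} \<le> card {S \<in> [{1..n}]\<^bsup>k\<^esup>. S \<inter> ?Pop \<noteq> {}}"
    using F finS by (intro card_mono) auto
  also have "\<dots> \<le> card ?Pop * ((n - 1) choose (k - 1))"
    using card_nsets_hit_le[OF finite_atLeastAtMost PopV, of k] by simp
  also have "\<dots> \<le> d * ((n - 1) choose (k - 1))" using few d by (intro mult_right_mono) auto
  also have "(n - 1) choose (k - 1) \<le> (b choose (k - 1)) + d * n ^ (k - 2)"
  proof -
    have "(b + d) choose Suc k' \<le> (b choose Suc k') + d * (b + d) ^ k'" by (rule binomial_diff_upper)
    moreover have "d * (b + d) ^ k' \<le> d * n ^ k'" unfolding n by (intro mult_left_mono power_mono) auto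
    moreover have "n - 1 = b + d" "k - 1 = Suc k'" "k - 2 = k'" using n k' by simp_all
    ultimately show ?thesis by (simp only:)
  qed
  finally have hit: "card {S \<in> F. S \<inter> ?Pop \<noteq> {}} \<le> d * (b choose (k - 1)) + d * d * n ^ (k - 2)"
    by (simp add: algebra_simps)
  have "F = {S \<in> F. S \<inter> ?Pop \<noteq> {}} \<union> {S \<in> F. S \<inter> ?Pop = {}}" by blast
  then have "card F \<le> card {S \<in> F. S \<inter> ?Pop \<noteq> {}} + card {S \<in> F. S \<inter> ?Pop = {}}"
    using card_Un_le[of "{S \<in> F. S \<inter> ?Pop \<noteq> {}}" "{S \<in> F. S \<inter> ?Pop = {}}"] by argo
  then have up: "card F \<le> d * (b choose (k - 1)) + d * d * n ^ (k - 2) + sum_list ss * (k * (C * n ^ (k - 2)))"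
    using hit away by linarith
  have "(b choose Suc (k - 1)) + (d + 1) * (b choose (k - 1)) \<le> (b + (d + 1)) choose Suc (k - 1)"
    by (rule binomial_diff_lower)
  then have low: "(d + 1) * (b choose (k - 1)) \<le> card F"
    using big k unfolding b_def[symmetric] n[symmetric] by simp
  have "d * d * n ^ (k - 2) \<le> r * r * n ^ (k - 2)" unfolding d by (intro mult_right_mono mult_mono) auto
  moreover have "r * r * n ^ (k - 2) + sum_list ss * (k * (C * n ^ (k - 2))) < b choose (k - 1)"
    using large by (simp add: algebra_simps b_def)
  moreover have "(d + 1) * (b choose (k - 1)) = d * (b choose (k - 1)) + (b choose (k - 1))" by simp
  ultimately show False using up low by linarith
qed

text \<open>Supplies the numerical assumptions of \<open>sparse_family\<close>. Here
  \<open>\<gamma> \<le> k - 2\<close> makes the degree \<open>k - 1 - \<gamma>\<close> positive;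
  beating \<open>m\<close> in the third inequality takes degree at least 2.\<close>

lemma eventually_large:
  assumes "k \<ge> 5" "\<gamma> \<le> k - 2"
  shows "\<exists>m0. \<forall>m\<ge>m0.
    ((k - 2) * (k - 2) + k * k * (k + t) + (k + 1) * t) * m ^ (k - 3) < (m - k) choose (k - 2) \<and>
    t * t * k < (m - k - \<gamma> - 1) choose (k - 1 - \<gamma>) \<and>
    (2 \<le> k - 1 - \<gamma> \<longrightarrow> m < (m - k - \<gamma>) choose (k - 1 - \<gamma>)) \<and> 3 * k \<le> m"
proof -
  let ?c = "(k - 2) * (k - 2) + k * k * (k + t) + (k + 1) * t"
  have j: "1 \<le> k - 1 - \<gamma>" using assms by linarith
  have k2: "1 \<le> k - 2" "k - 2 - 1 = k - 3" using assms by linarith+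
  obtain m1 where m1: "\<forall>m\<ge>m1. ?c * m ^ (k - 3) < (m - k) choose (k - 2)"
    using binomial_eventually_gt[OF k2(1), of ?c k] unfolding k2(2) by blast
  obtain m2 where m2: "\<forall>m\<ge>m2. t * t * k * m ^ (k - 1 - \<gamma> - 1) < (m - (k + \<gamma> + 1)) choose (k - 1 - \<gamma>)"
    using binomial_eventually_gt[OF j, of "t * t * k" "k + \<gamma> + 1"] by blast
  obtain m3 where m3: "\<forall>m\<ge>m3. 1 * m ^ (k - 1 - \<gamma> - 1) < (m - (k + \<gamma>)) choose (k - 1 - \<gamma>)"
    using binomial_eventually_gt[OF j, of 1 "k + \<gamma>"] by blast
  show ?thesis
  proof (intro exI[of _ "m1 + m2 + m3 + 3 * k"] allI impI conjI)
    fix m assume m: "m1 + m2 + m3 + 3 * k \<le> m"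
    have m0: "1 \<le> m" using m assms by linarith
    show "?c * m ^ (k - 3) < (m - k) choose (k - 2)" using m1 m by simp
    show "3 * k \<le> m" using m by simp
    have "t * t * k * 1 \<le> t * t * k * m ^ (k - 1 - \<gamma> - 1)" using m0 by (intro mult_left_mono) simp_all
    also have "\<dots> < (m - (k + \<gamma> + 1)) choose (k - 1 - \<gamma>)" using m2 m by simp
    also have "m - (k + \<gamma> + 1) = m - k - \<gamma> - 1" by simp
    finally show "t * t * k < (m - k - \<gamma> - 1) choose (k - 1 - \<gamma>)" by (simp only: mult_1_right)
    assume "2 \<le> k - 1 - \<gamma>"
    then have "m ^ 1 \<le> m ^ (k - 1 - \<gamma> - 1)" using m0 by (intro power_increasing) simp_all
    also have "\<dots> < (m - (k + \<gamma>)) choose (k - 1 - \<gamma>)" using m3 m by simp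
    also have "m - (k + \<gamma>) = m - k - \<gamma>" by simp
    finally show "m < (m - k - \<gamma>) choose (k - 1 - \<gamma>)" by (simp only: power_one_right)
  qed
qed

theorem theorem4:
  fixes k r \<beta> \<gamma> :: nat and s :: "nat list"
  assumes "k \<ge> 5" and "r \<ge> 1"
    and "length s = r" and "sorted_wrt (\<ge>) s" and "last s \<ge> 1"
    and "\<gamma> = 1 + \<beta>" and "\<gamma> \<le> k - 2"
  shows "\<exists>n\<^sub>0. \<forall>n\<ge>n\<^sub>0. \<forall>\<F> \<subseteq> [{1..n}]\<^bsup>k\<^esup>.
           \<not> contains_subgraph (with_proj (kneser_graph n k) \<restriction> \<F>)
               (with_proj (complete_multipartite (s @ [1]))) \<longrightarrow>
           ell (r + 1) \<F> \<ge> \<gamma> \<longrightarrow>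
           (let bound = int (n choose k) - int ((n - r) choose k)
                  - int ((n - k - r + 1) choose (k - 1))
                  + int ((n - k - r - \<gamma> + 1) choose (k - \<gamma> - 1))
                  + int (\<gamma> * last s)
            in int (card \<F>) \<le> bound \<and>
               (int (card \<F>) = bound \<longleftrightarrow>
                  (\<exists>\<G>. is_J_family n k r \<gamma> (last s) \<G> \<and> isomorphic_families n \<F> \<G>)))"
proof -
  define t where "t = last s"
  \<comment> \<open>The constant demanded by \<open>degree_away_from_popular_less\<close> for
    \<open>card P = r - 1\<close>; popularity is measured with it, so that popular elements can
    supply the missing parts.\<close>
  define C where "C = (t + 1) * k + (r - 1) * (sum_list s * k + 1) + sum_list s"
  have s: "s \<noteq> []" using assms(2,3) by auto
  have k2: "1 \<le> k - 1" "k - 1 - 1 = k - 2" using assms(1) by linarith+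
  obtain n1 where n1: "\<forall>n\<ge>n1. (r * r + sum_list (s @ [1]) * (k * C)) * n ^ (k - 2) < (n - (r - 1)) choose (k - 1)"
    using binomial_eventually_gt[OF k2(1), of "r * r + sum_list (s @ [1]) * (k * C)" "r - 1"] unfolding k2(2) by blast
  obtain m0 where m0: "\<forall>m\<ge>m0.
    ((k - 2) * (k - 2) + k * k * (k + t) + (k + 1) * t) * m ^ (k - 3) < (m - k) choose (k - 2) \<and>
    t * t * k < (m - k - \<gamma> - 1) choose (k - 1 - \<gamma>) \<and>
    (2 \<le> k - 1 - \<gamma> \<longrightarrow> m < (m - k - \<gamma>) choose (k - 1 - \<gamma>)) \<and> 3 * k \<le> m"
    using eventually_large[OF assms(1,7), of t] by blast
  \<comment> \<open>It suffices that a family of size at least \<open>B\<close> has size exactly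
    \<open>B\<close> and is extremal: this contains the upper bound as well as one direction of the
    equality case.\<close>
  have main: "(B \<le> card F \<longrightarrow> card F = B \<and> (\<exists>\<G>. is_J_family n k r \<gamma> t \<G> \<and> isomorphic_families n F \<G>))
      \<and> ((\<exists>\<G>. is_J_family n k r \<gamma> t \<G> \<and> isomorphic_families n F \<G>) \<longrightarrow> card F = B)"
    if n: "n1 + m0 + r + k + \<gamma> \<le> n" and F: "F \<subseteq> [{1..n}]\<^bsup>k\<^esup>"
      and free: "\<not> contains_subgraph (with_proj (kneser_graph n k) \<restriction> F) (with_proj (complete_multipartite (s @ [1])))"
      and ell: "ell (r + 1) F \<ge> \<gamma>"
      and B: "B = (n choose k) - ((n - (r - 1)) choose k) + hm_bound (n - (r - 1)) k \<gamma> t"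
    for n F B
  proof (intro conjI impI)
    assume "\<exists>\<G>. is_J_family n k r \<gamma> t \<G> \<and> isomorphic_families n F \<G>"
    then obtain \<G> where \<G>: "is_J_family n k r \<gamma> t \<G>" "isomorphic_families n F \<G>" by blast
    show "card F = B"
      unfolding B by (rule card_isomorphic_to_J_family[OF \<G>]) (use assms n in \<open>simp_all add: t_def\<close>)
  next
    assume big: "B \<le> card F"
    have rn: "r \<le> n" using n by simp
    have "r - 1 \<le> card {p \<in> {1..n}. C * n ^ (k - 2) \<le> card {S \<in> F. p \<in> S}}"
    proof (rule many_popular_elements[OF F _ assms(2) rn free])
      show "(r * r + sum_list (s @ [1]) * (k * C)) * n ^ (k - 2) < (n - (r - 1)) choose (k - 1)"
        using n1 n by simp
      show "(n choose k) - ((n - (r - 1)) choose k) \<le> card F" using big B by linarith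
    qed (use assms(1) in simp)
    then obtain P where P: "P \<subseteq> {p \<in> {1..n}. C * n ^ (k - 2) \<le> card {S \<in> F. p \<in> S}}"
      "card P = r - 1" "finite P"
      by (rule obtain_subset_with_card_n)
    have Pn: "P \<subseteq> {1..n}" using P(1) by blast
    let ?V = "{1..n} - P" and ?F = "{S \<in> F. S \<inter> P = {}}"
    have cV: "card ?V = n - (r - 1)" using P Pn by (subst card_Diff_subset) auto
    have finS: "finite ([{1..n}]\<^bsup>k\<^esup>)" by (simp add: finite_imp_finite_nsets)
    have finF: "finite F" using F finS by (rule finite_subset)
    have chit: "card {S \<in> [{1..n}]\<^bsup>k\<^esup>. S \<inter> P \<noteq> {}} = (n choose k) - ((n - (r - 1)) choose k)"
      using card_nsets_hit[of "{1..n}" P k] Pn P(2) by simp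
    have hit_le: "card {S \<in> F. S \<inter> P \<noteq> {}} \<le> card {S \<in> [{1..n}]\<^bsup>k\<^esup>. S \<inter> P \<noteq> {}}"
      using F finS by (intro card_mono) auto
    have split: "card F = card {S \<in> F. S \<inter> P \<noteq> {}} + card ?F"
    proof -
      have "F = {S \<in> F. S \<inter> P \<noteq> {}} \<union> ?F" by blast
      moreover have "card ({S \<in> F. S \<inter> P \<noteq> {}} \<union> ?F) = card {S \<in> F. S \<inter> P \<noteq> {}} + card ?F"
        using finF by (intro card_Un_disjoint) auto
      ultimately show ?thesis by argo
    qed
    have m: "m0 \<le> card ?V" unfolding cV using n assms(2) by linarith
    interpret sparse_family ?V k t \<gamma> ?F
    proof
      show "?F \<subseteq> [?V]\<^bsup>k\<^esup>" using F by (auto simp: nsets_def)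
      show "card {B \<in> ?F. A \<inter> B = {}} < t" if "A \<in> ?F" for A
        unfolding t_def
      proof (rule degree_away_from_popular_less[OF F _ _ free Pn])
        show "C * n ^ (k - 2) \<le> card {S \<in> F. p \<in> S}" if "p \<in> P" for p using P(1) that by blast
        show "(last s + 1) * k + card P * (sum_list s * k + 1) + sum_list s \<le> C"
          by (simp only: C_def t_def P(2))
      qed (use that assms(1-3) s P(2) rn in auto)
      show "\<gamma> \<le> card D" if "D \<subseteq> ?F" "\<forall>A\<in>?F - D. \<forall>B\<in>?F - D. A \<inter> B \<noteq> {}" for D
        using ell ell_le_card_away[OF finF P(3,2) assms(2) that] by linarith
      \<comment> \<open>The members meeting \<open>P\<close> are at most all \<open>k\<close>-sets
        that meet \<open>P\<close>, so the remainder of \<open>B\<close> is left for those avoiding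
        it.\<close>
      show "hm_bound (card ?V) k \<gamma> t \<le> card ?F"
        unfolding cV using split hit_le chit big B by linarith
    qed (use assms m0[rule_format, OF m] in simp_all)
    from perturbed_HM_structure obtain c where cF: "card ?F = hm_bound (card ?V) k \<gamma> t"
      and c: "perturbed_HM ?V k c \<gamma> t ?F" by blast
    show "card F = B" using split hit_le chit big B cF unfolding cV by linarith
    \<comment> \<open>The members avoiding \<open>P\<close> number exactly \<open>hm_bound\<close>,
      so no \<open>k\<close>-set that meets \<open>P\<close> can be missing from
      \<open>F\<close>.\<close>
    then have "card {S \<in> F. S \<inter> P \<noteq> {}} = card {S \<in> [{1..n}]\<^bsup>k\<^esup>. S \<inter> P \<noteq> {}}"
      using split chit B cF unfolding cV by linarith
    then have "{S \<in> F. S \<inter> P \<noteq> {}} = {S \<in> [{1..n}]\<^bsup>k\<^esup>. S \<inter> P \<noteq> {}}"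
      using finS F by (intro card_subset_eq) auto
    then have "F = {S \<in> [{1..n}]\<^bsup>k\<^esup>. S \<inter> P \<noteq> {}} \<union> ?F" by blast
    then show "\<exists>\<G>. is_J_family n k r \<gamma> t \<G> \<and> isomorphic_families n F \<G>"
      by (rule isomorphic_to_J_familyI[OF Pn P(2) assms(2) rn c])
  qed
  show ?thesis
  proof (intro exI[of _ "n1 + m0 + r + k + \<gamma>"] allI impI)
    fix n \<F>
    assume n: "n1 + m0 + r + k + \<gamma> \<le> n" and F: "\<F> \<subseteq> [{1..n}]\<^bsup>k\<^esup>"
      and free: "\<not> contains_subgraph (with_proj (kneser_graph n k) \<restriction> \<F>) (with_proj (complete_multipartite (s @ [1])))"
      and ell: "ell (r + 1) \<F> \<ge> \<gamma>"
    have "r + k + \<gamma> \<le> n" "1 \<le> k" using n assms(1) by linarith+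
    note bound = int_bound_eq[OF assms(2) this assms(7)]
    show "let bound = int (n choose k) - int ((n - r) choose k)
                  - int ((n - k - r + 1) choose (k - 1))
                  + int ((n - k - r - \<gamma> + 1) choose (k - \<gamma> - 1))
                  + int (\<gamma> * last s)
            in int (card \<F>) \<le> bound \<and>
               (int (card \<F>) = bound \<longleftrightarrow>
                  (\<exists>\<G>. is_J_family n k r \<gamma> (last s) \<G> \<and> isomorphic_families n \<F> \<G>))"
      unfolding Let_def bound of_nat_le_iff of_nat_eq_iff
      using main[OF n F free ell refl] unfolding t_def by (metis linear order_refl)
  qed
qed

end
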